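(* Under the Campbell--Shiller approximation approach (described in the context), the candidate solution to the HJBI equation is given by $$v^{\mathrm{CS}}(t,x,m)=\frac1{1-\gamma}x^{1-\gamma}\big(g^{\mathrm{CS}}(t,m)\big)^k,\qquad(t,x,m)\in[0,T]\times\mathbb R^+\times\mathbb R.$$ Here the function $g^{\mathrm{CS}}$ is $$g^{\mathrm{CS}}(t,m)=e^{G(t)m^2+L(t)m+H(t)},$$ where $$\begin{aligned} G(t)&=2G_3\frac{e^{\sqrt{G_2^2-4G_1G_3}(T-t)}-1}{e^{\sqrt{G_2^2-4G_1G_3}(T-t)}\big(G_2+\sqrt{G_2^2-4G_1G_3}\big)-G_2+\sqrt{G_2^2-4G_1G_3}},\\ L(t)&=\frac{(1-\gamma)(a-r)}{k(\Phi+\gamma)\sigma}\int_t^T\Big(2\frac{1-\gamma-\Phi}{1-\gamma}k\beta\rho_1G(s)+1\Big)e^{\int_t^s\left(\frac{1-\gamma-\Phi}{\Phi+\gamma}\beta\rho_1-\alpha-w-G_1G(u)\right)du}\,ds,\\ H(t)&=\int_t^T\Big[\tfrac12(\beta^2+2G_0)L^2(s)+\frac{(1-\gamma-\Phi)(a-r)}{(\Phi+\gamma)\sigma}\beta\rho_1L(s)+\beta^2G(s)\Big]e^{\delta(s-t)}ds\\ &\quad+\frac{1-\gamma}{k}\Big[\frac w{\varphi-1}(1-\ln w+\varphi\ln\delta)+r-\frac{\delta}{1-\frac1\varphi}+\frac{(a-r)^2}{2(\Phi+\gamma)\sigma^2}+\frac{\lambda\theta_1^2\mu_1^2}{2(\Phi+\gamma)\mu_2}\Big]\big(e^{w(T-t)}-1\big),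 \end{aligned}$$ with $$G_1:=-2(\beta^2+2G_0),\quad G_2:=2\alpha+w-\frac{2(1-\gamma-\Phi)\beta\rho_1}{\Phi+\gamma},\quad G_3:=-\frac{1-\gamma}{2k(\Phi+\gamma)},$$ $$G_0:=\frac{(1-\gamma-\Phi)^2k\beta^2\rho_1^2}{2(\Phi+\gamma)(1-\gamma)^2}-\frac{\Phi k^2\beta^2}{2(1-\gamma)}+\frac{\beta^2(k-1)}2.$$ The corresponding strategies are, with $x(t)=X_t$ the current wealth, $$\begin{aligned} \pi^{\mathrm{CS}}(t)&=\frac{x(t)}{(\Phi+\gamma)\sigma^2}\Big[(\sigma m(t)+a-r)+\frac{1-\gamma-\Phi}{1-\gamma}k\beta\rho_1\sigma\frac{g^{\mathrm{CS}}_m(t,m(t))}{g^{\mathrm{CS}}(t,m(t))}\Big],\\ q^{\mathrm{CS}}(t)&=\frac{\theta_1\mu_1}{(\Phi+\gamma)\mu_2}x(t),\qquad c^{\mathrm{CS}}(t)=x(t)\,\delta^\varphi\big(g^{\mathrm{CS}}(t,m(t))\big)^{k\frac{1-\varphi}{1-\gamma}}, \end{aligned}$$ and the distortion process $\xi^{\mathrm{CS}}=(\xi_1^{\mathrm{CS}},\xi_2^{\mathrm{CS}},\xi_3^{\mathrm{CS}})$ is $$\begin{aligned} \xi_1^{\mathrm{CS}}(t)&=\frac{\Phi}{(\Phi+\gamma)\sigma}(\sigma m(t)+a-r)+\frac{\Phi k\beta\rho_1}{(\Phi+\gamma)(1-\gamma)}\big(2G(t)m(t)+L(t)\big),\\ \xi_2^{\mathrm{CS}}(t)&=\frac{\Phi}{1-\gamma}k\beta\sqrt{1-\rho_1^2}\,\big(2G(t)m(t)+L(t)\big),\qquad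 \xi_3^{\mathrm{CS}}(t)=\frac{\Phi\theta_1\mu_1\sqrt\lambda}{(\Phi+\gamma)\sqrt{\mu_2}}. \end{aligned}$$
   Context: Parameters. $T>0$ finite horizon; $r>0$, $a>r$, $\sigma>0$, $\alpha>0$, $\beta>0$, $|\rho_1|\le1$ (market parameters); $\lambda$ the claim intensity, $\mu_1,\mu_2$ the first and second moments of the (positive) claim size, $\theta_1$ the reinsurer's safety loading; $\delta>0$ (rate of time preference), $0<\gamma\ne1$ (relative risk aversion), $0<\varphi\ne1$ (elasticity of intertemporal substitution), $\Phi\ge0$ (ambiguity-aversion constant); $k$ is a constant (the exponent of $g$ in the conjectured value function). Dynamics. For a distortion process $\xi=(\xi_1,\xi_2,\xi_3)$ let $\mathbb Q^\xi$ be the measure equivalent to the reference measure under which $W_i^{\mathbb Q^\xi}=W_i+\int_0^\cdot\xi_i(s)ds$, $i=1,2,3$, are Brownian motions ($W_1,W_2,W_3$ independent Brownian motions under the reference measure). Under $\mathbb Q^\xi$ the drift factor $m$ of the risky asset and the insurer's (transformed total) wealth $X$ satisfy $$dm(t)=-\big[\alpha m(t)+\beta\rho_1\xi_1(t)+\beta\sqrt{1-\rho_1^2}\,\xi_2(t)\big]dt+\beta\big(\rho_1dW^{\mathbb Q^\xi}_{1,t}+\sqrt{1-\rho_1^2}\,dW^{\mathbb Q^\xi}_{2,t}\big),$$ $$dX_t=\big[\pi(t)(\sigma m(t)+a-r)+rX_t+\lambda\mu_1\theta_1q(t)-c(t)-\pi(t)\sigma\xi_1(t)-q(t)\sqrt{\lambda\mu_2}\,\xi_3(t)\big]dt+\sigma\pi(t)dW^{\mathbb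 Q^\xi}_{1,t}+\sqrt{\lambda\mu_2}\,q(t)dW^{\mathbb Q^\xi}_{3,t},$$ where $\pi$ is the amount invested in the risky asset, $q$ the retained risk proportion, and $c$ the consumption rate. HJBI equation. With the Epstein--Zin aggregator $f(c,v)=(1-\frac1\varphi)^{-1}\delta(1-\gamma)v\big[\big(c\,((1-\gamma)v)^{-1/(1-\gamma)}\big)^{1-1/\varphi}-1\big]$ and robustness parameter $\Psi=\frac{\Phi}{(1-\gamma)v}$, the HJBI equation is $$\begin{aligned}\max_{(\pi,q,c)}\min_{\xi}\Big\{& f(c,v)+v_t+v_x\big[rx+(\sigma m+a-r)\pi+\lambda\mu_1\theta_1q-c-\sigma\xi_1\pi-\sqrt{\lambda\mu_2}\,\xi_3q\big]-v_m\big(\alpha m+\beta\rho_1\xi_1+\beta\sqrt{1-\rho_1^2}\,\xi_2\big)\\&+\tfrac12v_{xx}(\sigma^2\pi^2+\lambda\mu_2q^2)+\tfrac12v_{mm}\beta^2+v_{xm}\sigma\beta\rho_1\pi+\tfrac1{2\Psi}(\xi_1^2+\xi_2^2+\xi_3^2)\Big\}=0,\quad v(T,x,m)=\tfrac1{1-\gamma}x^{1-\gamma}.\end{aligned}$$ Campbell--Shiller approximation approach. Inserting $v=\frac1{1-\gamma}x^{1-\gamma}g(t,m)^k$ and the first-order-condition controls into the HJBI equation gives a PDE for $g$ in which the consumption--wealth ratio is $\frac cx=\delta^\varphi g^{k\frac{1-\varphi}{1-\gamma}}$. The approximation replaces this ratio by its first-order log-linear expansion around its long-run steady state, $$\frac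 cx\approx w\Big(1-\ln w+\ln\delta^\varphi+k\frac{1-\varphi}{1-\gamma}\ln g\Big),\qquad \ln w=\mathbb E^{\mathbb Q^\xi}\Big[\ln\Big(\frac cx\Big)(m_\infty)\Big],$$ where $m_\infty$ is a random variable with the stationary distribution of the process $m$, and $w$ is treated as a fixed constant. The resulting equation for the approximation $g^{\mathrm{CS}}$ of $g$ is $$\begin{aligned} &g^{\mathrm{CS}}_t+\frac{1-\gamma}{k(\varphi-1)}w\Big(1-\ln w+\varphi\ln\delta+k\frac{1-\varphi}{1-\gamma}\ln g^{\mathrm{CS}}\Big)g^{\mathrm{CS}}\\ &+\frac{1-\gamma}k\Big[\frac{(\sigma m+a-r)^2}{2(\Phi+\gamma)\sigma^2}+\frac{\lambda\theta_1^2\mu_1^2}{2(\Phi+\gamma)\mu_2}+r-\frac\delta{1-\frac1\varphi}\Big]g^{\mathrm{CS}}+\tfrac12\beta^2g^{\mathrm{CS}}_{mm}\\ &+\Big[\frac{1-\gamma-\Phi}{(\Phi+\gamma)\sigma}(\sigma m+a-r)\beta\rho_1-\alpha m\Big]g^{\mathrm{CS}}_m\\ &+\Big[\frac{(1-\gamma-\Phi)^2}{2(\Phi+\gamma)(1-\gamma)}k\beta^2\rho_1^2-\frac{\Phi k\beta^2}{2(1-\gamma)}+\frac{\beta^2(k-1)}2\Big]\frac{(g^{\mathrm{CS}}_m)^2}{g^{\mathrm{CS}}}=0, \end{aligned}$$ and it is solved through the exponential-quadratic form $g^{\mathrm{CS}}=e^{G(t)m^2+L(t)m+H(t)}$.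
   Formalization: Corrected: G has the opposite sign; in G_0, (1-γ)^2 and k^2 become 1-γ and k; in H, e^{δ(s-t)} becomes e^{-w(s-t)} and e^{w(T-t)}-1 becomes (1-e^{-w(T-t)})/w. Assumed: G_2^2-4G_1G_3≥0 and the denominator of G nonzero on [0,T]. *)

theory Defs
  imports "HOL-Probability.Probability"
begin

text \<open>
  The paper states the strategies as processes evaluated along the state \<open>(t, X\<^sub>t, m(t))\<close>. Here
  strategies and distortions are feedback functions of \<open>(t, x, m)\<close>; the dynamics of \<open>X\<close> and \<open>m\<close>
  enter only through the drift and diffusion coefficients in the HJBI equation.
  The claim intensity is written \<open>lam\<close>.
\<close>

definition is_claim_law :: "real measure \<Rightarrow> real \<Rightarrow> real \<Rightarrow> bool" where
  "is_claim_law N \<mu>\<^sub>1 \<mu>\<^sub>2 \<longleftrightarrow>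
     prob_space N \<and> sets N = sets borel \<and> (AE z in N. 0 < z) \<and> integrable N (\<lambda>z. z\<^sup>2) \<and>
     \<mu>\<^sub>1 = (\<integral>z. z \<partial>N) \<and> \<mu>\<^sub>2 = (\<integral>z. z\<^sup>2 \<partial>N)"

definition ez_aggregator :: "real \<Rightarrow> real \<Rightarrow> real \<Rightarrow> real \<Rightarrow> real \<Rightarrow> real" where
  "ez_aggregator \<delta> \<gamma> \<phi> c v =
     inverse (1 - 1 / \<phi>) * \<delta> * (1 - \<gamma>) * v *
       ((c * ((1 - \<gamma>) * v) powr (- 1 / (1 - \<gamma>))) powr (1 - 1 / \<phi>) - 1)"

text \<open>
  The penalty \<open>s / (2 \<Psi>)\<close> for \<open>s = \<xi>\<^sub>1\<^sup>2 + \<xi>\<^sub>2\<^sup>2 + \<xi>\<^sub>3\<^sup>2\<close>. Ambiguity aversion \<open>\<Phi> = 0\<close> is allowed, so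
  \<open>\<Psi> = 0\<close> has to be read as an infinite penalty on every nonzero distortion; with
  \<open>s / 0 = 0\<close> the penalty would vanish instead. This is why the HJBI bracket is extended real.
\<close>

definition penalty :: "real \<Rightarrow> real \<Rightarrow> ereal" where
  "penalty \<Psi> s = (if \<Psi> = 0 then (if s = 0 then 0 else \<infinity>) else ereal (s / (2 * \<Psi>)))"

text \<open>
  The expression in braces in the HJBI equation, at a point with factor value \<open>m\<close>, wealth \<open>x\<close> and
  values \<open>v, vt, vx, vm, vxx, vmm, vxm\<close> of the value function and its partial derivatives.
\<close>

definition hjbi_bracket ::
  "real \<Rightarrow> real \<Rightarrow> real \<Rightarrow> real \<Rightarrow> real \<Rightarrow> real \<Rightarrow> real \<Rightarrow> real \<Rightarrow> real \<Rightarrow> real \<Rightarrow> real \<Rightarrow> real \<Rightarrow> real \<Rightarrow> real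
   \<Rightarrow> real \<Rightarrow> real \<Rightarrow> real \<Rightarrow> real \<Rightarrow> real \<Rightarrow> real \<Rightarrow> real \<Rightarrow> real \<Rightarrow> real
   \<Rightarrow> real \<times> real \<times> real \<Rightarrow> real \<times> real \<times> real \<Rightarrow> ereal" where
  "hjbi_bracket r a \<sigma> \<alpha> \<beta> \<rho>\<^sub>1 lam \<mu>\<^sub>1 \<mu>\<^sub>2 \<theta>\<^sub>1 \<delta> \<gamma> \<phi> \<Phi> x m v vt vx vm vxx vmm vxm =
     (\<lambda>(\<pi>, q, c) (\<xi>\<^sub>1, \<xi>\<^sub>2, \<xi>\<^sub>3).
        ereal (ez_aggregator \<delta> \<gamma> \<phi> c v + vt
          + vx * (r * x + (\<sigma> * m + a - r) * \<pi> + lam * \<mu>\<^sub>1 * \<theta>\<^sub>1 * q - c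
                    - \<sigma> * \<xi>\<^sub>1 * \<pi> - sqrt (lam * \<mu>\<^sub>2) * \<xi>\<^sub>3 * q)
          - vm * (\<alpha> * m + \<beta> * \<rho>\<^sub>1 * \<xi>\<^sub>1 + \<beta> * sqrt (1 - \<rho>\<^sub>1\<^sup>2) * \<xi>\<^sub>2)
          + 1/2 * vxx * (\<sigma>\<^sup>2 * \<pi>\<^sup>2 + lam * \<mu>\<^sub>2 * q\<^sup>2) + 1/2 * vmm * \<beta>\<^sup>2
          + vxm * \<sigma> * \<beta> * \<rho>\<^sub>1 * \<pi>)
        + penalty (\<Phi> / ((1 - \<gamma>) * v)) (\<xi>\<^sub>1\<^sup>2 + \<xi>\<^sub>2\<^sup>2 + \<xi>\<^sub>3\<^sup>2))"

text \<open>
  Amounts invested and retained proportions are unconstrained; consumption rates are positive,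
  because \<open>c powr (1 - 1 / \<phi>)\<close> is \<open>0\<close>, not infinite, at \<open>c = 0\<close> and \<open>\<phi> < 1\<close>.
\<close>

definition controls :: "(real \<times> real \<times> real) set" where
  "controls = {(\<pi>, q, c). 0 < c}"

text \<open>\<open>max\<close> over \<open>u \<in> U\<close> of \<open>min\<close> over \<open>\<xi>\<close> of \<open>B u \<xi>\<close> is attained at \<open>u\<close>, with inner minimum at \<open>\<xi>\<close>.\<close>

definition attains_max_min :: "'u set \<Rightarrow> ('u \<Rightarrow> 'd \<Rightarrow> ereal) \<Rightarrow> 'u \<Rightarrow> 'd \<Rightarrow> bool" where
  "attains_max_min U B u \<xi> \<longleftrightarrow>
     u \<in> U \<and> (\<forall>\<zeta>. B u \<xi> \<le> B u \<zeta>) \<and> (\<forall>u'\<in>U. (INF \<zeta>. B u' \<zeta>) \<le> (INF \<zeta>. B u \<zeta>))"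

text \<open>
  Partial derivatives on \<open>[0,T] \<times> (0,\<infinity>) \<times> \<real>\<close> and \<open>[0,T] \<times> \<real>\<close>; the time derivative is one-sided at
  the endpoints.
\<close>

definition value_partials ::
  "real \<Rightarrow> (real \<Rightarrow> real \<Rightarrow> real \<Rightarrow> real) \<Rightarrow> (real \<Rightarrow> real \<Rightarrow> real \<Rightarrow> real) \<Rightarrow> (real \<Rightarrow> real \<Rightarrow> real \<Rightarrow> real)
   \<Rightarrow> (real \<Rightarrow> real \<Rightarrow> real \<Rightarrow> real) \<Rightarrow> (real \<Rightarrow> real \<Rightarrow> real \<Rightarrow> real) \<Rightarrow> (real \<Rightarrow> real \<Rightarrow> real \<Rightarrow> real)
   \<Rightarrow> (real \<Rightarrow> real \<Rightarrow> real \<Rightarrow> real) \<Rightarrow> bool" where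
  "value_partials T v vt vx vm vxx vmm vxm \<longleftrightarrow>
     (\<forall>t\<in>{0..T}. \<forall>x>0. \<forall>m.
        ((\<lambda>s. v s x m) has_real_derivative vt t x m) (at t within {0..T}) \<and>
        ((\<lambda>y. v t y m) has_real_derivative vx t x m) (at x) \<and>
        ((\<lambda>n. v t x n) has_real_derivative vm t x m) (at m) \<and>
        ((\<lambda>y. vx t y m) has_real_derivative vxx t x m) (at x) \<and>
        ((\<lambda>n. vm t x n) has_real_derivative vmm t x m) (at m) \<and>
        ((\<lambda>n. vx t x n) has_real_derivative vxm t x m) (at m))"

definition factor_partials ::
  "real \<Rightarrow> (real \<Rightarrow> real \<Rightarrow> real) \<Rightarrow> (real \<Rightarrow> real \<Rightarrow> real) \<Rightarrow> (real \<Rightarrow> real \<Rightarrow> real)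
   \<Rightarrow> (real \<Rightarrow> real \<Rightarrow> real) \<Rightarrow> bool" where
  "factor_partials T g gt gm gmm \<longleftrightarrow>
     (\<forall>t\<in>{0..T}. \<forall>m.
        ((\<lambda>s. g s m) has_real_derivative gt t m) (at t within {0..T}) \<and>
        ((\<lambda>n. g t n) has_real_derivative gm t m) (at m) \<and>
        ((\<lambda>n. gm t n) has_real_derivative gmm t m) (at m))"

text \<open>
  First-order expansion of the consumption-wealth ratio \<open>exp (ln (c/x))\<close> in \<open>ln (c/x)\<close> around \<open>ln w\<close>,
  for \<open>c/x = \<delta> powr \<phi> * g powr (k * (1 - \<phi>) / (1 - \<gamma>))\<close>. The steady-state value
  \<open>w = exp (E [ln (c/x) (m\<^sub>\<infinity>)])\<close> enters the approximated equation as a fixed constant, so it is an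
  arbitrary positive parameter here.
\<close>

definition cs_ratio :: "real \<Rightarrow> real \<Rightarrow> real \<Rightarrow> real \<Rightarrow> real \<Rightarrow> real \<Rightarrow> real" where
  "cs_ratio \<delta> \<gamma> \<phi> k w g =
     w * (1 - ln w + ln (\<delta> powr \<phi>) + k * ((1 - \<phi>) / (1 - \<gamma>)) * ln g)"

text \<open>
  Left-hand side of the equation for \<open>g\<close>, with the consumption-wealth ratio as an argument \<open>R\<close>. The
  equation for \<open>g\<close> before approximation has \<open>R = \<delta> powr \<phi> * g powr (k * (1 - \<phi>) / (1 - \<gamma>))\<close>, the
  Campbell-Shiller equation has \<open>R = cs_ratio \<delta> \<gamma> \<phi> k w g\<close>.
\<close>

definition g_equation ::
  "real \<Rightarrow> real \<Rightarrow> real \<Rightarrow> real \<Rightarrow> real \<Rightarrow> real \<Rightarrow> real \<Rightarrow> real \<Rightarrow> real \<Rightarrow> real \<Rightarrow> real \<Rightarrow> real \<Rightarrow> real \<Rightarrow> real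
   \<Rightarrow> real \<Rightarrow> real \<Rightarrow> real \<Rightarrow> real \<Rightarrow> real \<Rightarrow> real \<Rightarrow> real \<Rightarrow> real" where
  "g_equation r a \<sigma> \<alpha> \<beta> \<rho>\<^sub>1 lam \<mu>\<^sub>1 \<mu>\<^sub>2 \<theta>\<^sub>1 \<delta> \<gamma> \<phi> \<Phi> k m R g gt gm gmm =
     gt + (1 - \<gamma>) / (k * (\<phi> - 1)) * R * g
     + (1 - \<gamma>) / k * ((\<sigma> * m + a - r)\<^sup>2 / (2 * (\<Phi> + \<gamma>) * \<sigma>\<^sup>2)
          + lam * \<theta>\<^sub>1\<^sup>2 * \<mu>\<^sub>1\<^sup>2 / (2 * (\<Phi> + \<gamma>) * \<mu>\<^sub>2) + r - \<delta> / (1 - 1 / \<phi>)) * g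
     + 1/2 * \<beta>\<^sup>2 * gmm
     + ((1 - \<gamma> - \<Phi>) / ((\<Phi> + \<gamma>) * \<sigma>) * (\<sigma> * m + a - r) * \<beta> * \<rho>\<^sub>1 - \<alpha> * m) * gm
     + ((1 - \<gamma> - \<Phi>)\<^sup>2 / (2 * (\<Phi> + \<gamma>) * (1 - \<gamma>)) * k * \<beta>\<^sup>2 * \<rho>\<^sub>1\<^sup>2
          - \<Phi> * k * \<beta>\<^sup>2 / (2 * (1 - \<gamma>)) + \<beta>\<^sup>2 * (k - 1) / 2) * (gm\<^sup>2 / g)"

text \<open>
  With \<open>g = exp (G(t) m\<^sup>2 + L(t) m + H(t))\<close> the Campbell-Shiller equation, divided by \<open>g\<close>, is quadratic
  in \<open>m\<close>. Let \<open>G\<^sub>0\<close> be the coefficient of \<open>gm\<^sup>2 / g\<close> above, \<open>G\<^sub>1 = - 2 (\<beta>\<^sup>2 + 2 G\<^sub>0)\<close>,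
  \<open>G\<^sub>2 = 2 \<alpha> + w - 2 (1 - \<gamma> - \<Phi>) \<beta> \<rho>\<^sub>1 / (\<Phi> + \<gamma>)\<close>, \<open>G\<^sub>3 = - (1 - \<gamma>) / (2 k (\<Phi> + \<gamma>))\<close>. Then the powers
  of \<open>m\<close> give, with zero terminal values,
    \<open>G' = G\<^sub>1 G\<^sup>2 + G\<^sub>2 G + G\<^sub>3\<close>,
    \<open>L' = - ((1 - \<gamma> - \<Phi>) / (\<Phi> + \<gamma>) \<beta> \<rho>\<^sub>1 - \<alpha> - w - G\<^sub>1 G) L
          - (1 - \<gamma>) (a - r) / (k (\<Phi> + \<gamma>) \<sigma>) (2 (1 - \<gamma> - \<Phi>) / (1 - \<gamma>) k \<beta> \<rho>\<^sub>1 G + 1)\<close>,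
    \<open>H' = w H - (\<beta>\<^sup>2 + 2 G\<^sub>0) L\<^sup>2 / 2 - (1 - \<gamma> - \<Phi>) (a - r) / ((\<Phi> + \<gamma>) \<sigma>) \<beta> \<rho>\<^sub>1 L - \<beta>\<^sup>2 G - C\<close>
  for the constant \<open>C\<close> collecting the terms free of \<open>m\<close>, \<open>G\<close>, \<open>L\<close>, \<open>H\<close>.
  The closed forms in the theorem solve these equations. The printed ones do not, and are corrected
  in four places: the sign of \<open>G\<close>; the factors \<open>(1 - \<gamma>)\<^sup>2\<close> and \<open>k\<^sup>2\<close> in \<open>G\<^sub>0\<close>, which should be
  \<open>1 - \<gamma>\<close> and \<open>k\<close>; the factor \<open>exp (\<delta> (s - t))\<close> in \<open>H\<close>, which should be \<open>exp (- w (s - t))\<close>; and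
  the factor \<open>exp (w (T - t)) - 1\<close> in \<open>H\<close>, which should be \<open>(1 - exp (- w (T - t))) / w\<close>.
\<close>

end

theory Submission
  imports Defs
begin

text \<open>
  The value function is of power type in wealth, \<open>v = x powr (1 - \<gamma>) * g powr k / (1 - \<gamma>)\<close>, and for such
  functions the max-min problem in the HJBI equation can be solved explicitly at each point. With
  \<open>V = (1 - \<gamma>) v > 0\<close> and \<open>\<Psi> = \<Phi> / V\<close>, the inner problem is affine plus a quadratic penalty, and its
  minimum subtracts \<open>\<Psi> / 2\<close> times a sum of squares (\<open>hjbi_bracket_worst_case\<close>). The outer problem then separates:
  investment and retention are concave quadratics with effective risk aversion \<open>\<gamma> + \<Phi>\<close>, and consumption is
  a concave power minus a linear function (\<open>ez_consumption\<close>, \<open>powr_tangent_at_1\<close>). The maximiser is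
  the strategy in the theorem, and the maximum equals \<open>k v / g\<close> times the left-hand side of the
  equation for \<open>g\<close> at the optimal consumption-wealth ratio (\<open>hjbi_power_utility\<close>).

  That equation is affine in the consumption-wealth ratio. Hence, if \<open>g\<close> solves the equation with the
  log-linear ratio instead, the max-min of the bracket is proportional to the approximation error of the ratio,
  and the correction term in the theorem is its negative.

  It remains to solve the approximated equation. For \<open>g = exp (G m\<^sup>2 + L m + H)\<close> the
  log-linear ratio is quadratic in \<open>m\<close>, so the equation reduces to a Riccati equation for \<open>G\<close> and
  linear equations for \<open>L\<close> and \<open>H\<close> (\<open>cs_equation_exponential_quadratic\<close>), with zero terminal values. The
  closed forms solve them: the first by direct differentiation (\<open>riccati_solution\<close>), the others by
  variation of constants backward from \<open>T\<close> (\<open>backward_variation_of_constants\<close>).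
\<close>

section \<open>Worst-case distortions\<close>

text \<open>
  For \<open>\<Psi> > 0\<close> the difference of the two sides of the bound is
  \<open>((\<xi>\<^sub>1 - \<Psi> b\<^sub>1)\<^sup>2 + (\<xi>\<^sub>2 - \<Psi> b\<^sub>2)\<^sup>2 + (\<xi>\<^sub>3 - \<Psi> b\<^sub>3)\<^sup>2) / (2 \<Psi>)\<close>. For \<open>\<Psi> = 0\<close> only the zero distortion
  has finite penalty, and \<open>\<Psi> b = 0\<close>, so the same formulas cover the ambiguity-neutral case.
\<close>

lemma penalty_worst_case:
  assumes "0 \<le> \<Psi>"
  shows "ereal (A - b\<^sub>1 * (\<Psi> * b\<^sub>1) - b\<^sub>2 * (\<Psi> * b\<^sub>2) - b\<^sub>3 * (\<Psi> * b\<^sub>3))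
           + penalty \<Psi> ((\<Psi> * b\<^sub>1)\<^sup>2 + (\<Psi> * b\<^sub>2)\<^sup>2 + (\<Psi> * b\<^sub>3)\<^sup>2)
         = ereal (A - \<Psi> / 2 * (b\<^sub>1\<^sup>2 + b\<^sub>2\<^sup>2 + b\<^sub>3\<^sup>2))" (is ?attained)
    and "ereal (A - \<Psi> / 2 * (b\<^sub>1\<^sup>2 + b\<^sub>2\<^sup>2 + b\<^sub>3\<^sup>2))
         \<le> ereal (A - b\<^sub>1 * \<xi>\<^sub>1 - b\<^sub>2 * \<xi>\<^sub>2 - b\<^sub>3 * \<xi>\<^sub>3) + penalty \<Psi> (\<xi>\<^sub>1\<^sup>2 + \<xi>\<^sub>2\<^sup>2 + \<xi>\<^sub>3\<^sup>2)" (is ?bound)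
proof -
  show ?attained
    by (cases "\<Psi> = 0") (simp_all add: penalty_def field_simps power2_eq_square)
  show ?bound
  proof (cases "\<Psi> = 0")
    case True
    have "\<xi>\<^sub>1 = 0 \<and> \<xi>\<^sub>2 = 0 \<and> \<xi>\<^sub>3 = 0" if "\<xi>\<^sub>1\<^sup>2 + \<xi>\<^sub>2\<^sup>2 + \<xi>\<^sub>3\<^sup>2 = 0"
      using that by (smt (verit) zero_le_power2 zero_eq_power2)
    then show ?thesis
      using True by (auto simp: penalty_def)
  next
    case False
    then have "0 < \<Psi>" using assms by simp
    have "0 \<le> ((\<xi>\<^sub>1 - \<Psi> * b\<^sub>1)\<^sup>2 + (\<xi>\<^sub>2 - \<Psi> * b\<^sub>2)\<^sup>2 + (\<xi>\<^sub>3 - \<Psi> * b\<^sub>3)\<^sup>2) / (2 * \<Psi>)"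
      using \<open>0 < \<Psi>\<close> by simp
    also have "\<dots> = (A - b\<^sub>1 * \<xi>\<^sub>1 - b\<^sub>2 * \<xi>\<^sub>2 - b\<^sub>3 * \<xi>\<^sub>3 + (\<xi>\<^sub>1\<^sup>2 + \<xi>\<^sub>2\<^sup>2 + \<xi>\<^sub>3\<^sup>2) / (2 * \<Psi>))
        - (A - \<Psi> / 2 * (b\<^sub>1\<^sup>2 + b\<^sub>2\<^sup>2 + b\<^sub>3\<^sup>2))"
      using \<open>0 < \<Psi>\<close> by (simp add: field_simps power2_eq_square)
    finally show ?thesis
      using False by (simp add: penalty_def)
  qed
qed

text \<open>
  The bracket is affine in the distortion apart from the penalty, so its minimum \<open>W\<close> is explicit.
  Ambiguity acts on it only by shifting the second derivatives to \<open>vxx - \<Psi> vx\<^sup>2\<close>, \<open>vmm - \<Psi> vm\<^sup>2\<close> and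
  \<open>vxm - \<Psi> vx vm\<close>. The term in \<open>vm\<^sup>2\<close> carries no \<open>\<rho>\<^sub>1\<close>, because the loadings \<open>\<beta> \<rho>\<^sub>1\<close> and
  \<open>\<beta> sqrt (1 - \<rho>\<^sub>1\<^sup>2)\<close> of the factor have squared length \<open>\<beta>\<^sup>2\<close>.
\<close>

lemma hjbi_bracket_worst_case:
  fixes r a \<sigma> \<alpha> \<beta> \<rho>\<^sub>1 lam \<mu>\<^sub>1 \<mu>\<^sub>2 \<theta>\<^sub>1 \<delta> \<gamma> \<phi> \<Phi> :: real
    and x m v vt vx vm vxx vmm vxm \<pi> q c :: real
  assumes "0 \<le> \<Phi> / ((1 - \<gamma>) * v)" "\<bar>\<rho>\<^sub>1\<bar> \<le> 1" "0 \<le> lam * \<mu>\<^sub>2"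
  defines "\<Psi> \<equiv> \<Phi> / ((1 - \<gamma>) * v)"
  defines "B \<equiv> hjbi_bracket r a \<sigma> \<alpha> \<beta> \<rho>\<^sub>1 lam \<mu>\<^sub>1 \<mu>\<^sub>2 \<theta>\<^sub>1 \<delta> \<gamma> \<phi> \<Phi> x m v vt vx vm vxx vmm vxm"
    and "W \<equiv> ez_aggregator \<delta> \<gamma> \<phi> c v - vx * c + vt
          + vx * (r * x + (\<sigma> * m + a - r) * \<pi> + lam * \<mu>\<^sub>1 * \<theta>\<^sub>1 * q) - vm * \<alpha> * m
          + 1/2 * (vxx - \<Psi> * vx\<^sup>2) * (\<sigma>\<^sup>2 * \<pi>\<^sup>2 + lam * \<mu>\<^sub>2 * q\<^sup>2)
          + 1/2 * (vmm - \<Psi> * vm\<^sup>2) * \<beta>\<^sup>2 + (vxm - \<Psi> * vx * vm) * \<sigma> * \<beta> * \<rho>\<^sub>1 * \<pi>"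
  shows "B (\<pi>, q, c) (\<Psi> * (vx * \<sigma> * \<pi> + vm * \<beta> * \<rho>\<^sub>1), \<Psi> * (vm * \<beta> * sqrt (1 - \<rho>\<^sub>1\<^sup>2)),
           \<Psi> * (vx * sqrt (lam * \<mu>\<^sub>2) * q)) = ereal W"
    and "ereal W \<le> B (\<pi>, q, c) \<zeta>"
proof -
  define b\<^sub>1 b\<^sub>2 b\<^sub>3 where b: "b\<^sub>1 = vx * \<sigma> * \<pi> + vm * \<beta> * \<rho>\<^sub>1"
    "b\<^sub>2 = vm * \<beta> * sqrt (1 - \<rho>\<^sub>1\<^sup>2)" "b\<^sub>3 = vx * sqrt (lam * \<mu>\<^sub>2) * q"
  define A where "A = ez_aggregator \<delta> \<gamma> \<phi> c v + vt
          + vx * (r * x + (\<sigma> * m + a - r) * \<pi> + lam * \<mu>\<^sub>1 * \<theta>\<^sub>1 * q - c) - vm * (\<alpha> * m)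
          + 1/2 * vxx * (\<sigma>\<^sup>2 * \<pi>\<^sup>2 + lam * \<mu>\<^sub>2 * q\<^sup>2) + 1/2 * vmm * \<beta>\<^sup>2
          + vxm * \<sigma> * \<beta> * \<rho>\<^sub>1 * \<pi>"
  have "\<rho>\<^sub>1\<^sup>2 \<le> 1" using assms(2) by (simp add: abs_square_le_1)
  then have sq: "b\<^sub>2\<^sup>2 = vm\<^sup>2 * \<beta>\<^sup>2 * (1 - \<rho>\<^sub>1\<^sup>2)" "b\<^sub>3\<^sup>2 = vx\<^sup>2 * (lam * \<mu>\<^sub>2) * q\<^sup>2"
    using assms(3) by (simp_all add: b power_mult_distrib)
  have W: "W = A - \<Psi> / 2 * (b\<^sub>1\<^sup>2 + b\<^sub>2\<^sup>2 + b\<^sub>3\<^sup>2)"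
    unfolding sq unfolding b W_def A_def by (simp add: field_simps power2_eq_square)
  have B: "B (\<pi>, q, c) (\<xi>\<^sub>1, \<xi>\<^sub>2, \<xi>\<^sub>3) = ereal (A - b\<^sub>1 * \<xi>\<^sub>1 - b\<^sub>2 * \<xi>\<^sub>2 - b\<^sub>3 * \<xi>\<^sub>3)
      + penalty \<Psi> (\<xi>\<^sub>1\<^sup>2 + \<xi>\<^sub>2\<^sup>2 + \<xi>\<^sub>3\<^sup>2)" for \<xi>\<^sub>1 \<xi>\<^sub>2 \<xi>\<^sub>3
    unfolding B_def hjbi_bracket_def \<Psi>_def A_def b by (simp add: algebra_simps)
  have "0 \<le> \<Psi>" using assms(1) by (simp add: \<Psi>_def)
  then show "B (\<pi>, q, c) (\<Psi> * (vx * \<sigma> * \<pi> + vm * \<beta> * \<rho>\<^sub>1), \<Psi> * (vm * \<beta> * sqrt (1 - \<rho>\<^sub>1\<^sup>2)),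
           \<Psi> * (vx * sqrt (lam * \<mu>\<^sub>2) * q)) = ereal W"
    unfolding B W b[symmetric] by (rule penalty_worst_case)
  obtain \<xi>\<^sub>1 \<xi>\<^sub>2 \<xi>\<^sub>3 where \<zeta>: "\<zeta> = (\<xi>\<^sub>1, \<xi>\<^sub>2, \<xi>\<^sub>3)" by (cases \<zeta>)
  show "ereal W \<le> B (\<pi>, q, c) \<zeta>"
    unfolding \<zeta> B W by (rule penalty_worst_case(2)[OF \<open>0 \<le> \<Psi>\<close>])
qed


section \<open>Consumption under Epstein-Zin preferences\<close>

text \<open>
  The function \<open>y powr p / p\<close> is concave for \<open>p < 1\<close>, also for negative \<open>p\<close>, and lies below its tangent
  at \<open>1\<close>. With \<open>p = 1 - 1 / \<phi>\<close> this bounds the gain from consumption for elasticities on both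
  sides of \<open>1\<close>.
\<close>

lemma powr_tangent_at_1:
  fixes p y :: real
  assumes "p \<noteq> 0" "p < 1" "0 < y"
  shows "y powr p / p - y \<le> 1 / p - 1"
proof -
  have "convex_on {0<..} (\<lambda>y. - (y powr p / p))"
  proof (rule f''_ge0_imp_convex)
    fix z :: real assume z: "z \<in> {0<..}"
    show "((\<lambda>y. - (y powr p / p)) has_real_derivative - (z powr (p - 1))) (at z)"
      using z assms by (auto intro!: derivative_eq_intros)
    show "((\<lambda>y. - (y powr (p - 1))) has_real_derivative - ((p - 1) * z powr (p - 1 - 1))) (at z)"
      using z assms by (auto intro!: derivative_eq_intros)
    show "0 \<le> - ((p - 1) * z powr (p - 1 - 1))"
      using assms by (simp add: mult_nonpos_nonneg)
  qed simp
  moreover have "((\<lambda>y. - (y powr p / p)) has_real_derivative - 1) (at 1 within {0<..})"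
    using assms by (auto intro!: derivative_eq_intros)
  ultimately have "- (y powr p / p) \<ge> - (1 powr p / p) + - 1 * (y - 1)"
    using assms(3) convex_on_imp_above_tangent[of "{0<..}" "\<lambda>y. - (y powr p / p)" 1 y "- 1"]
    by (simp add: interior_open)
  then show ?thesis by simp
qed

text \<open>
  The number \<open>R\<close> is the consumption-wealth ratio at which marginal utility from the aggregator equals
  the marginal value \<open>V / x\<close> of wealth. Measuring consumption in units of \<open>x R\<close> leaves a multiple of
  \<open>y powr p / p - y\<close> with \<open>p = 1 - 1 / \<phi>\<close>, whose maximum is at \<open>y = 1\<close>.
\<close>

lemma ez_consumption:
  fixes \<delta> \<gamma> \<phi> k x g c :: real
  assumes "0 < \<delta>" "\<gamma> \<noteq> 1" "0 < \<phi>" "\<phi> \<noteq> 1" "0 < x" "0 < g"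
  defines "V \<equiv> x powr (1 - \<gamma>) * g powr k"
    and "R \<equiv> \<delta> powr \<phi> * g powr (k * ((1 - \<phi>) / (1 - \<gamma>)))"
  shows "ez_aggregator \<delta> \<gamma> \<phi> c (V / (1 - \<gamma>)) - V / x * c
           = V * (R * ((c / (x * R)) powr (1 - 1 / \<phi>) / (1 - 1 / \<phi>) - c / (x * R)) - \<delta> / (1 - 1 / \<phi>))"
proof -
  define p where "p = 1 - 1 / \<phi>"
  have pos: "0 < V" "0 < R" using assms by (simp_all add: V_def R_def)
  have V': "V powr (- 1 / (1 - \<gamma>)) = g powr (- k / (1 - \<gamma>)) / x"
  proof -
    have "V powr (- 1 / (1 - \<gamma>)) = x powr ((1 - \<gamma>) * (- 1 / (1 - \<gamma>))) * g powr (k * (- 1 / (1 - \<gamma>)))"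
      using assms by (simp add: V_def powr_mult powr_powr)
    also have "(1 - \<gamma>) * (- 1 / (1 - \<gamma>)) = - 1" using assms by simp
    also have "x powr - 1 = 1 / x" using assms by (simp add: powr_minus_divide)
    finally show ?thesis by simp
  qed
  have \<phi>p: "\<phi> * p = \<phi> - 1" using assms by (simp add: p_def field_simps)
  \<comment> \<open>The first-order condition for consumption at the ratio \<open>R\<close>, multiplied by \<open>R\<close>: marginal utility
      divided by \<open>V / x\<close> is \<open>1\<close> there.\<close>
  have scale: "\<delta> * (R * g powr (- k / (1 - \<gamma>))) powr p = R"
  proof -
    have "\<delta> * (R * g powr (- k / (1 - \<gamma>))) powr p
       = \<delta> powr (1 + \<phi> * p) * g powr ((k * ((1 - \<phi>) / (1 - \<gamma>)) + (- k / (1 - \<gamma>))) * p)"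
      using assms(1,6) powr_one[of \<delta>]
      by (simp only: R_def mult.assoc powr_add[symmetric] powr_mult powr_powr)
         (simp add: powr_add)
    also have "1 + \<phi> * p = \<phi>" using \<phi>p by simp
    also have "(k * ((1 - \<phi>) / (1 - \<gamma>)) + (- k / (1 - \<gamma>))) * p = - (k / (1 - \<gamma>)) * (\<phi> * p)"
      by (simp add: divide_inverse algebra_simps)
    also have "\<dots> = k * ((1 - \<phi>) / (1 - \<gamma>))"
      unfolding \<phi>p by (simp add: divide_inverse algebra_simps)
    finally show ?thesis by (simp add: R_def)
  qed
  have "c * V powr (- 1 / (1 - \<gamma>)) = (c / (x * R)) * (R * g powr (- k / (1 - \<gamma>)))"
    unfolding V' using pos \<open>0 < x\<close> by simp
  moreover have "((c / (x * R)) * (R * g powr (- k / (1 - \<gamma>)))) powr p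
      = (c / (x * R)) powr p * (R * g powr (- k / (1 - \<gamma>))) powr p"
    by (rule powr_mult)
  ultimately have consumed: "\<delta> * (c * V powr (- 1 / (1 - \<gamma>))) powr p = (c / (x * R)) powr p * R"
    by (simp only: mult.left_commute[of \<delta>] scale)
  have ez: "ez_aggregator \<delta> \<gamma> \<phi> c u = inverse p * \<delta> * U * ((c * U powr (- 1 / (1 - \<gamma>))) powr p - 1)"
    if "(1 - \<gamma>) * u = U" for u U
    unfolding that[symmetric] by (simp only: ez_aggregator_def p_def mult.assoc)
  have "(1 - \<gamma>) * (V / (1 - \<gamma>)) = V" using \<open>\<gamma> \<noteq> 1\<close> by simp
  note ez[OF this]
  also have "inverse p * \<delta> * V * ((c * V powr (- 1 / (1 - \<gamma>))) powr p - 1)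
      = inverse p * V * (\<delta> * (c * V powr (- 1 / (1 - \<gamma>))) powr p - \<delta>)"
    by (simp only: right_diff_distrib mult_1_right mult_ac)
  also have "\<dots> = V * (R * ((c / (x * R)) powr p / p) - \<delta> / p)"
    unfolding consumed by (simp only: divide_inverse right_diff_distrib mult_ac)
  finally have "ez_aggregator \<delta> \<gamma> \<phi> c (V / (1 - \<gamma>)) = V * (R * ((c / (x * R)) powr p / p) - \<delta> / p)" .
  moreover have "V / x * c = V * (R * (c / (x * R)))"
    using pos \<open>0 < x\<close> by simp
  ultimately show ?thesis
    unfolding p_def[symmetric] by (simp only: right_diff_distrib)
qed

section \<open>Value functions of power type\<close>

text \<open>
  For \<open>v = V / (1 - \<gamma>)\<close> with \<open>V = x powr (1 - \<gamma>) * g powr k\<close>, ambiguity aversion is \<open>\<Psi> = \<Phi> / V\<close>, so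
  the quadratic coefficient of the controls is \<open>- V (\<gamma> + \<Phi>) / x\<^sup>2\<close>: the robust investor behaves like
  one with risk aversion \<open>\<gamma> + \<Phi>\<close>, whatever the sign of \<open>1 - \<gamma>\<close>. Completing the squares in
  investment and retention, together with the tangent inequality for consumption, splits the bracket
  into a value \<open>M\<close> free of controls minus nonnegative terms that vanish at the stated strategy.
\<close>

lemma hjbi_power_utility:
  fixes r a \<sigma> \<alpha> \<beta> \<rho>\<^sub>1 lam \<mu>\<^sub>1 \<mu>\<^sub>2 \<theta>\<^sub>1 \<delta> \<gamma> \<phi> \<Phi> k :: real
    and x m g gt gm gmm :: real
  assumes par: "\<sigma> > 0" "\<bar>\<rho>\<^sub>1\<bar> \<le> 1" "lam > 0" "\<mu>\<^sub>2 > 0"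
      "\<delta> > 0" "\<gamma> > 0" "\<gamma> \<noteq> 1" "\<phi> > 0" "\<phi> \<noteq> 1" "\<Phi> \<ge> 0" "k \<noteq> 0"
    and pos: "x > 0" "g > 0"
  defines "V \<equiv> x powr (1 - \<gamma>) * g powr k"
    and "R \<equiv> \<delta> powr \<phi> * g powr (k * ((1 - \<phi>) / (1 - \<gamma>)))"
  defines "\<pi>' \<equiv> x / ((\<Phi> + \<gamma>) * \<sigma>\<^sup>2) *
              ((\<sigma> * m + a - r) + (1 - \<gamma> - \<Phi>) / (1 - \<gamma>) * k * \<beta> * \<rho>\<^sub>1 * \<sigma> * (gm / g))"
    and "q' \<equiv> \<theta>\<^sub>1 * \<mu>\<^sub>1 / ((\<Phi> + \<gamma>) * \<mu>\<^sub>2) * x"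
    and "\<xi>\<^sub>1' \<equiv> \<Phi> / ((\<Phi> + \<gamma>) * \<sigma>) * (\<sigma> * m + a - r)
              + \<Phi> * k * \<beta> * \<rho>\<^sub>1 / ((\<Phi> + \<gamma>) * (1 - \<gamma>)) * (gm / g)"
    and "\<xi>\<^sub>2' \<equiv> \<Phi> / (1 - \<gamma>) * k * \<beta> * sqrt (1 - \<rho>\<^sub>1\<^sup>2) * (gm / g)"
    and "\<xi>\<^sub>3' \<equiv> \<Phi> * \<theta>\<^sub>1 * \<mu>\<^sub>1 * sqrt lam / ((\<Phi> + \<gamma>) * sqrt \<mu>\<^sub>2)"
    and "B \<equiv> hjbi_bracket r a \<sigma> \<alpha> \<beta> \<rho>\<^sub>1 lam \<mu>\<^sub>1 \<mu>\<^sub>2 \<theta>\<^sub>1 \<delta> \<gamma> \<phi> \<Phi> x m (V / (1 - \<gamma>))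
              (V * k / (1 - \<gamma>) * (gt / g)) (V / x) (V * k / (1 - \<gamma>) * (gm / g)) (- \<gamma> * V / x\<^sup>2)
              (V * k / (1 - \<gamma>) * (gmm / g + (k - 1) * (gm / g)\<^sup>2)) (V / x * k * (gm / g))"
  shows "attains_max_min controls B (\<pi>', q', x * R) (\<xi>\<^sub>1', \<xi>\<^sub>2', \<xi>\<^sub>3')"
    and "(SUP u\<in>controls. INF \<xi>. B u \<xi>) =
           ereal (V * k / (1 - \<gamma>) / g *
             g_equation r a \<sigma> \<alpha> \<beta> \<rho>\<^sub>1 lam \<mu>\<^sub>1 \<mu>\<^sub>2 \<theta>\<^sub>1 \<delta> \<gamma> \<phi> \<Phi> k m R g gt gm gmm)"
proof -
  define p where "p = gm / g"
  define b where "b = \<sigma> * m + a - r"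
  define s where "s = b + (1 - \<gamma> - \<Phi>) / (1 - \<gamma>) * k * \<beta> * \<rho>\<^sub>1 * \<sigma> * p"
  define y where "y = s / ((\<Phi> + \<gamma>) * \<sigma>\<^sup>2)"
  define z where "z = \<theta>\<^sub>1 * \<mu>\<^sub>1 / ((\<Phi> + \<gamma>) * \<mu>\<^sub>2)"
  define \<Psi> where "\<Psi> = \<Phi> / V"
  have V: "0 < V" and R: "0 < R" using pos par by (simp_all add: V_def R_def)
  have PG: "0 < \<Phi> + \<gamma>" using par by simp
  have \<gamma>1: "1 - \<gamma> \<noteq> 0" using par by simp
  have Psi: "\<Phi> / ((1 - \<gamma>) * (V / (1 - \<gamma>))) = \<Psi>" using par by (simp add: \<Psi>_def)
  have Psi0: "0 \<le> \<Phi> / ((1 - \<gamma>) * (V / (1 - \<gamma>)))" unfolding Psi using V par by (simp add: \<Psi>_def)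
  have lam0: "0 \<le> lam * \<mu>\<^sub>2" using par by simp
  define W where "W \<pi> q c = ez_aggregator \<delta> \<gamma> \<phi> c (V / (1 - \<gamma>)) - V / x * c
       + V * k / (1 - \<gamma>) * (gt / g)
       + V / x * (r * x + b * \<pi> + lam * \<mu>\<^sub>1 * \<theta>\<^sub>1 * q) - V * k / (1 - \<gamma>) * p * \<alpha> * m
       + 1/2 * (- \<gamma> * V / x\<^sup>2 - \<Psi> * (V / x)\<^sup>2) * (\<sigma>\<^sup>2 * \<pi>\<^sup>2 + lam * \<mu>\<^sub>2 * q\<^sup>2)
       + 1/2 * (V * k / (1 - \<gamma>) * (gmm / g + (k - 1) * p\<^sup>2) - \<Psi> * (V * k / (1 - \<gamma>) * p)\<^sup>2) * \<beta>\<^sup>2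
       + (V / x * k * p - \<Psi> * (V / x) * (V * k / (1 - \<gamma>) * p)) * \<sigma> * \<beta> * \<rho>\<^sub>1 * \<pi>" for \<pi> q c
  have attained: "B (\<pi>, q, c) (\<Psi> * (V / x * \<sigma> * \<pi> + V * k / (1 - \<gamma>) * p * \<beta> * \<rho>\<^sub>1),
      \<Psi> * (V * k / (1 - \<gamma>) * p * \<beta> * sqrt (1 - \<rho>\<^sub>1\<^sup>2)),
      \<Psi> * (V / x * sqrt (lam * \<mu>\<^sub>2) * q)) = ereal (W \<pi> q c)" 
    and lower: "ereal (W \<pi> q c) \<le> B (\<pi>, q, c) \<zeta>" for \<pi> q c \<zeta>
    unfolding B_def W_def p_def b_def Psi[symmetric]
    by (rule hjbi_bracket_worst_case[OF Psi0 par(2) lam0])+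
  have inf: "(INF \<zeta>. B (\<pi>, q, c) \<zeta>) = ereal (W \<pi> q c)" for \<pi> q c
  proof (rule antisym)
    show "(INF \<zeta>. B (\<pi>, q, c) \<zeta>) \<le> ereal (W \<pi> q c)"
      unfolding attained[symmetric] by (rule INF_lower[OF UNIV_I])
  qed (rule INF_greatest[OF lower])

  \<comment> \<open>The maximum per unit of \<open>V\<close>, apart from the terms in the relative consumption \<open>c / (x * R)\<close>.\<close>
  define C where "C = k / (1 - \<gamma>) * (gt / g) + r + s\<^sup>2 / (2 * (\<Phi> + \<gamma>) * \<sigma>\<^sup>2)
      + lam * \<theta>\<^sub>1\<^sup>2 * \<mu>\<^sub>1\<^sup>2 / (2 * (\<Phi> + \<gamma>) * \<mu>\<^sub>2) - k / (1 - \<gamma>) * p * \<alpha> * m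
      + 1/2 * \<beta>\<^sup>2 * (k / (1 - \<gamma>)) * (gmm / g + (k - 1) * p\<^sup>2) - 1/2 * \<Phi> * (k / (1 - \<gamma>) * p)\<^sup>2 * \<beta>\<^sup>2
      - \<delta> / (1 - 1 / \<phi>)"
  define e where "e = 1 - 1 / \<phi>"
  have e: "e \<noteq> 0" "e < 1" using par by (simp_all add: e_def)
  \<comment> \<open>Investment and retention relative to wealth enter only through squared distances to \<open>y\<close> and \<open>z\<close>.\<close>
  have squares: "W \<pi> q c = V * (C + R * ((c / (x * R)) powr e / e - c / (x * R))
      - 1/2 * (\<Phi> + \<gamma>) * (\<sigma>\<^sup>2 * (\<pi> / x - y)\<^sup>2 + lam * \<mu>\<^sub>2 * (q / x - z)\<^sup>2))" for \<pi> q c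
  proof -
    define Y where "Y = \<pi> / x"
    define Z where "Z = q / x"
    have x: "\<pi> = x * Y" "q = x * Z" using pos by (simp_all add: Y_def Z_def)
    have Y: "s * Y - 1/2 * (\<Phi> + \<gamma>) * \<sigma>\<^sup>2 * Y\<^sup>2
        = s\<^sup>2 / (2 * (\<Phi> + \<gamma>) * \<sigma>\<^sup>2) - 1/2 * (\<Phi> + \<gamma>) * \<sigma>\<^sup>2 * (Y - y)\<^sup>2"
      unfolding y_def using PG par by (simp add: divide_simps) algebra
    have Z: "lam * \<mu>\<^sub>1 * \<theta>\<^sub>1 * Z - 1/2 * (\<Phi> + \<gamma>) * (lam * \<mu>\<^sub>2) * Z\<^sup>2
        = lam * \<theta>\<^sub>1\<^sup>2 * \<mu>\<^sub>1\<^sup>2 / (2 * (\<Phi> + \<gamma>) * \<mu>\<^sub>2) - 1/2 * (\<Phi> + \<gamma>) * (lam * \<mu>\<^sub>2) * (Z - z)\<^sup>2"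
      unfolding z_def using PG par by (simp add: divide_simps) algebra
    have s: "s * Y = b * Y + (k * p - \<Phi> * (k / (1 - \<gamma>)) * p) * \<sigma> * \<beta> * \<rho>\<^sub>1 * Y"
      unfolding s_def using \<gamma>1 by (simp add: divide_simps) algebra
    have "W \<pi> q c = V * (R * ((c / (x * R)) powr e / e - c / (x * R)) - \<delta> / e
       + k / (1 - \<gamma>) * (gt / g)
       + (r + b * Y + lam * \<mu>\<^sub>1 * \<theta>\<^sub>1 * Z) - k / (1 - \<gamma>) * p * \<alpha> * m
       - 1/2 * (\<gamma> + \<Phi>) * (\<sigma>\<^sup>2 * Y\<^sup>2 + lam * \<mu>\<^sub>2 * Z\<^sup>2)
       + 1/2 * (k / (1 - \<gamma>) * (gmm / g + (k - 1) * p\<^sup>2) - \<Phi> * (k / (1 - \<gamma>) * p)\<^sup>2) * \<beta>\<^sup>2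
       + (k * p - \<Phi> * (k / (1 - \<gamma>)) * p) * \<sigma> * \<beta> * \<rho>\<^sub>1 * Y)"
    proof -
      have 1: "V / x * (r * x + b * \<pi> + lam * \<mu>\<^sub>1 * \<theta>\<^sub>1 * q) = V * (r + b * Y + lam * \<mu>\<^sub>1 * \<theta>\<^sub>1 * Z)"
        unfolding x using pos by (simp add: divide_simps) algebra
      have 2: "(- \<gamma> * V / x\<^sup>2 - \<Psi> * (V / x)\<^sup>2) * (\<sigma>\<^sup>2 * \<pi>\<^sup>2 + lam * \<mu>\<^sub>2 * q\<^sup>2)
         = - V * ((\<gamma> + \<Phi>) * (\<sigma>\<^sup>2 * Y\<^sup>2 + lam * \<mu>\<^sub>2 * Z\<^sup>2))"
        unfolding x \<Psi>_def using pos V by (simp add: divide_simps) algebra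
      have 3: "\<Psi> * (V * k / (1 - \<gamma>) * p)\<^sup>2 = V * (\<Phi> * (k / (1 - \<gamma>) * p)\<^sup>2)"
        unfolding \<Psi>_def using V \<gamma>1 by (simp add: divide_simps) algebra
      have 4: "(V / x * k * p - \<Psi> * (V / x) * (V * k / (1 - \<gamma>) * p)) * \<sigma> * \<beta> * \<rho>\<^sub>1 * \<pi>
         = V * ((k * p - \<Phi> * (k / (1 - \<gamma>)) * p) * \<sigma> * \<beta> * \<rho>\<^sub>1 * Y)"
        unfolding x \<Psi>_def using pos V \<gamma>1 by (simp add: divide_simps) algebra
      have 5: "ez_aggregator \<delta> \<gamma> \<phi> c (V / (1 - \<gamma>)) - V / x * c
         = V * (R * ((c / (x * R)) powr e / e - c / (x * R)) - \<delta> / e)"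
        using ez_consumption[OF par(5,7,8,9) pos] unfolding V_def R_def e_def .
      show ?thesis
        unfolding W_def 1 mult.assoc[of "1/2"] 2 3 4 5 by (simp add: algebra_simps)
    qed
    also have "\<dots> = V * (R * ((c / (x * R)) powr e / e - c / (x * R)) - \<delta> / e
       + k / (1 - \<gamma>) * (gt / g) + r
       + (s * Y - 1/2 * (\<Phi> + \<gamma>) * \<sigma>\<^sup>2 * Y\<^sup>2)
       + (lam * \<mu>\<^sub>1 * \<theta>\<^sub>1 * Z - 1/2 * (\<Phi> + \<gamma>) * (lam * \<mu>\<^sub>2) * Z\<^sup>2) - k / (1 - \<gamma>) * p * \<alpha> * m
       + 1/2 * (k / (1 - \<gamma>) * (gmm / g + (k - 1) * p\<^sup>2) - \<Phi> * (k / (1 - \<gamma>) * p)\<^sup>2) * \<beta>\<^sup>2)"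
      unfolding s by (simp add: algebra_simps)
    finally show ?thesis
      unfolding Y Z C_def Y_def[symmetric] Z_def[symmetric] e_def[symmetric]
      by (simp only: divide_inverse ring_distribs diff_conv_add_uminus mult_minus_left
          mult_minus_right minus_add_distrib minus_minus mult_ac add_ac)
  qed
  define M where "M = V * (C + R * (1 / e - 1))"
  have "0 < x * R" using pos R by simp
  then have top: "W \<pi>' q' (x * R) = M"
    using pos R by (simp add: squares M_def \<pi>'_def q'_def y_def z_def s_def b_def p_def)
  have bound: "W \<pi> q c \<le> M" if "0 < c" for \<pi> q c
  proof -
    have "R * ((c / (x * R)) powr e / e - c / (x * R)) \<le> R * (1 / e - 1)"
      using powr_tangent_at_1[OF e, of "c / (x * R)"] that pos R by (intro mult_left_mono) auto
    moreover have "0 \<le> 1/2 * (\<Phi> + \<gamma>) * (\<sigma>\<^sup>2 * (\<pi> / x - y)\<^sup>2 + lam * \<mu>\<^sub>2 * (q / x - z)\<^sup>2)"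
      using PG lam0 by simp
    ultimately show ?thesis
      unfolding squares M_def using V by (intro mult_left_mono) auto
  qed
  have star: "(\<pi>', q', x * R) \<in> controls" using \<open>0 < x * R\<close> by (simp add: controls_def)
  have le: "(INF \<zeta>. B u \<zeta>) \<le> ereal M" if "u \<in> controls" for u
    using that bound inf by (auto simp: controls_def)
  have eq: "(INF \<zeta>. B (\<pi>', q', x * R) \<zeta>) = ereal M" by (simp only: inf top)

  \<comment> \<open>The minimising distortion at the optimal controls, in the closed form of the statement: for \<open>\<xi>\<^sub>1\<close> the
      hedging term of \<open>\<pi>'\<close> and the direct factor term add up, by
      \<open>(1 - \<gamma> - \<Phi>) / (\<Phi> + \<gamma>) + 1 = 1 / (\<Phi> + \<gamma>)\<close>.\<close>
  have \<xi>: "\<xi>\<^sub>1' = \<Psi> * (V / x * \<sigma> * \<pi>' + V * k / (1 - \<gamma>) * p * \<beta> * \<rho>\<^sub>1)"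
    "\<xi>\<^sub>2' = \<Psi> * (V * k / (1 - \<gamma>) * p * \<beta> * sqrt (1 - \<rho>\<^sub>1\<^sup>2))"
    "\<xi>\<^sub>3' = \<Psi> * (V / x * sqrt (lam * \<mu>\<^sub>2) * q')"
  proof -
    show "\<xi>\<^sub>1' = \<Psi> * (V / x * \<sigma> * \<pi>' + V * k / (1 - \<gamma>) * p * \<beta> * \<rho>\<^sub>1)"
      unfolding \<xi>\<^sub>1'_def \<pi>'_def \<Psi>_def p_def[symmetric] b_def[symmetric]
      using V pos par(1) \<gamma>1 PG by (simp add: divide_simps) algebra
    show "\<xi>\<^sub>2' = \<Psi> * (V * k / (1 - \<gamma>) * p * \<beta> * sqrt (1 - \<rho>\<^sub>1\<^sup>2))"
      unfolding \<xi>\<^sub>2'_def \<Psi>_def p_def using V by simp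
    have "sqrt \<mu>\<^sub>2 * sqrt \<mu>\<^sub>2 = \<mu>\<^sub>2" using par by simp
    then show "\<xi>\<^sub>3' = \<Psi> * (V / x * sqrt (lam * \<mu>\<^sub>2) * q')"
      unfolding \<xi>\<^sub>3'_def q'_def \<Psi>_def real_sqrt_mult
      using V pos PG par(4) by (simp add: divide_simps)
  qed
  have min: "B (\<pi>', q', x * R) (\<xi>\<^sub>1', \<xi>\<^sub>2', \<xi>\<^sub>3') = ereal M"
    unfolding \<xi> attained top ..
  show "attains_max_min controls B (\<pi>', q', x * R) (\<xi>\<^sub>1', \<xi>\<^sub>2', \<xi>\<^sub>3')"
    unfolding attains_max_min_def eq min using star le lower top by metis
  have M: "M = V * k / (1 - \<gamma>) / g *
             g_equation r a \<sigma> \<alpha> \<beta> \<rho>\<^sub>1 lam \<mu>\<^sub>1 \<mu>\<^sub>2 \<theta>\<^sub>1 \<delta> \<gamma> \<phi> \<Phi> k m R g gt gm gmm"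
  proof -
    have s2: "s\<^sup>2 / (2 * (\<Phi> + \<gamma>) * \<sigma>\<^sup>2) = b\<^sup>2 / (2 * (\<Phi> + \<gamma>) * \<sigma>\<^sup>2)
        + k / (1 - \<gamma>) * ((1 - \<gamma> - \<Phi>) / ((\<Phi> + \<gamma>) * \<sigma>) * b * \<beta> * \<rho>\<^sub>1 * p
        + (1 - \<gamma> - \<Phi>)\<^sup>2 / (2 * (\<Phi> + \<gamma>) * (1 - \<gamma>)) * k * \<beta>\<^sup>2 * \<rho>\<^sub>1\<^sup>2 * p\<^sup>2)"
      unfolding s_def using PG \<gamma>1 par(1) by (simp add: divide_simps) algebra
    have e1: "1 / e - 1 = 1 / (\<phi> - 1)"
      using par unfolding e_def by (simp add: field_simps)
    define X where "X = b\<^sup>2 / (2 * (\<Phi> + \<gamma>) * \<sigma>\<^sup>2)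
          + lam * \<theta>\<^sub>1\<^sup>2 * \<mu>\<^sub>1\<^sup>2 / (2 * (\<Phi> + \<gamma>) * \<mu>\<^sub>2) + r - \<delta> / (1 - 1 / \<phi>)"
    define c\<^sub>1 where "c\<^sub>1 = (1 - \<gamma> - \<Phi>) / ((\<Phi> + \<gamma>) * \<sigma>) * b * \<beta> * \<rho>\<^sub>1"
    define c\<^sub>2 where "c\<^sub>2 = (1 - \<gamma> - \<Phi>)\<^sup>2 / (2 * (\<Phi> + \<gamma>) * (1 - \<gamma>)) * k * \<beta>\<^sup>2 * \<rho>\<^sub>1\<^sup>2"
    have L: "M = V * (X + k / (1 - \<gamma>) * (gt / g) + k / (1 - \<gamma>) * (c\<^sub>1 * p + c\<^sub>2 * p\<^sup>2)
      - k / (1 - \<gamma>) * p * \<alpha> * m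
      + 1/2 * \<beta>\<^sup>2 * (k / (1 - \<gamma>)) * (gmm / g + (k - 1) * p\<^sup>2) - 1/2 * \<Phi> * (k / (1 - \<gamma>) * p)\<^sup>2 * \<beta>\<^sup>2
      + R * (1 / (\<phi> - 1)))"
      unfolding M_def C_def s2 e1 X_def c\<^sub>1_def c\<^sub>2_def by (simp add: algebra_simps)
    show ?thesis
      unfolding L g_equation_def b_def[symmetric] X_def[symmetric] c\<^sub>1_def[symmetric] c\<^sub>2_def[symmetric] p_def
      using pos \<gamma>1 par(9,11) by (simp add: divide_simps) algebra
  qed
  show "(SUP u\<in>controls. INF \<xi>. B u \<xi>) =
           ereal (V * k / (1 - \<gamma>) / g *
             g_equation r a \<sigma> \<alpha> \<beta> \<rho>\<^sub>1 lam \<mu>\<^sub>1 \<mu>\<^sub>2 \<theta>\<^sub>1 \<delta> \<gamma> \<phi> \<Phi> k m R g gt gm gmm)"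
    unfolding M[symmetric] using eq le star by (intro antisym SUP_least) (auto intro: SUP_upper2)
qed

text \<open>
  All derivatives are written as multiples of \<open>V\<close> with the ratios \<open>gt / g\<close>, \<open>gm / g\<close>,
  \<open>gmm / g\<close> as factors, which is the form in which they enter the bracket above.
\<close>

lemma value_partials_power_utility:
  fixes g gt gm gmm :: "real \<Rightarrow> real \<Rightarrow> real" and \<gamma> k T :: real
  assumes "factor_partials T g gt gm gmm" "\<And>t m. 0 < g t m" "\<gamma> \<noteq> 1"
    and v: "\<And>t x m. v t x m = 1 / (1 - \<gamma>) * x powr (1 - \<gamma>) * g t m powr k"
  defines "V \<equiv> \<lambda>t x m. x powr (1 - \<gamma>) * g t m powr k"
  shows "value_partials T v
    (\<lambda>t x m. V t x m * k / (1 - \<gamma>) * (gt t m / g t m))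
    (\<lambda>t x m. V t x m / x)
    (\<lambda>t x m. V t x m * k / (1 - \<gamma>) * (gm t m / g t m))
    (\<lambda>t x m. - \<gamma> * V t x m / x\<^sup>2)
    (\<lambda>t x m. V t x m * k / (1 - \<gamma>) * (gmm t m / g t m + (k - 1) * (gm t m / g t m)\<^sup>2))
    (\<lambda>t x m. V t x m / x * k * (gm t m / g t m))"
  unfolding value_partials_def
proof (intro ballI allI impI)
  fix t x m :: real
  assume t: "t \<in> {0..T}" and x: "0 < x"
  have g: "0 < g t m" by (rule assms(2))
  have dt: "((\<lambda>s. g s m) has_real_derivative gt t m) (at t within {0..T})"
    and dm: "((\<lambda>n. g t n) has_real_derivative gm t m) (at m)"
    and dmm: "((\<lambda>n. gm t n) has_real_derivative gmm t m) (at m)"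
    using assms(1) t by (auto simp: factor_partials_def)
  have pw: "((\<lambda>s. f s powr k) has_real_derivative f y powr k * k * (f' / f y)) (at y within S)"
    if "(f has_real_derivative f') (at y within S)" "0 < f y" for f f' y S
    using DERIV_chain'[OF that(1) has_real_derivative_powr[OF that(2), of k]] that(2)
    by (simp add: powr_diff mult.commute mult.left_commute)
  have px: "((\<lambda>y. y powr (1 - \<gamma>)) has_real_derivative (1 - \<gamma>) * (x powr (1 - \<gamma>) / x)) (at x)"
  proof -
    have "x powr (1 - \<gamma> - 1) = x powr (1 - \<gamma>) / x" using x by (simp only: powr_diff) simp
    then show ?thesis using has_real_derivative_powr[OF x, of "1 - \<gamma>"] by (simp only:)
  qed
  note d = pw[OF dt g] pw[OF dm g] dm dmm px derivative_eq_intros refl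
  have nz: "1 - \<gamma> \<noteq> 0" "x \<noteq> 0" "g t m \<noteq> 0" using assms(3) x g by auto
  have dV: "((\<lambda>n. x powr (1 - \<gamma>) * g t n powr k * k / (1 - \<gamma>)) has_real_derivative
      x powr (1 - \<gamma>) * g t m powr k * k / (1 - \<gamma>) * (k * (gm t m / g t m))) (at m)"
    using DERIV_cmult[OF pw[OF dm g], of "x powr (1 - \<gamma>) * (k / (1 - \<gamma>))"] by (simp add: mult_ac)
  have dq: "((\<lambda>n. gm t n / g t n) has_real_derivative gmm t m / g t m - (gm t m / g t m)\<^sup>2) (at m)"
    by (rule DERIV_cong[OF DERIV_divide[OF dmm dm nz(3)]]) (simp add: nz field_simps power2_eq_square)
  have product: "Q * (k * p) * p + (q - p\<^sup>2) * Q = Q * (q + (k - 1) * p\<^sup>2)" for Q p q :: real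
    by algebra
  have cancel: "(1 - \<gamma>) * u * (1 / (1 - \<gamma>)) = u" for u using nz by simp
  show "((\<lambda>s. v s x m) has_real_derivative V t x m * k / (1 - \<gamma>) * (gt t m / g t m)) (at t within {0..T}) \<and>
        ((\<lambda>y. v t y m) has_real_derivative V t x m / x) (at x) \<and>
        ((\<lambda>n. v t x n) has_real_derivative V t x m * k / (1 - \<gamma>) * (gm t m / g t m)) (at m) \<and>
        ((\<lambda>y. V t y m / y) has_real_derivative - \<gamma> * V t x m / x\<^sup>2) (at x) \<and>
        ((\<lambda>n. V t x n * k / (1 - \<gamma>) * (gm t n / g t n)) has_real_derivative
           V t x m * k / (1 - \<gamma>) * (gmm t m / g t m + (k - 1) * (gm t m / g t m)\<^sup>2)) (at m) \<and>
        ((\<lambda>n. V t x n / x) has_real_derivative V t x m / x * k * (gm t m / g t m)) (at m)"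
    unfolding v V_def
  proof (intro conjI, goal_cases)
    case 1 show ?case by (rule nz d | (simp only: cancel mult_zero_left add_0 add_0_right times_divide_eq_left; fail)
        | (simp add: nz; fail) | (simp add: nz mult_ac; fail)
        | (simp add: nz field_simps power2_eq_square; fail))+
  next
    case 2 show ?case by (rule nz d | (simp only: cancel mult_zero_left add_0 add_0_right times_divide_eq_left; fail)
        | (simp add: nz; fail) | (simp add: nz mult_ac; fail)
        | (simp add: nz field_simps power2_eq_square; fail))+
  next
    case 3 show ?case by (rule nz d | (simp only: cancel mult_zero_left add_0 add_0_right times_divide_eq_left; fail)
        | (simp add: nz; fail) | (simp add: nz mult_ac; fail)
        | (simp add: nz field_simps power2_eq_square; fail))+
  next
    case 4 show ?case by (rule nz d | (simp only: cancel mult_zero_left add_0 add_0_right times_divide_eq_left; fail)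
        | (simp add: nz; fail) | (simp add: nz mult_ac; fail)
        | (simp add: nz field_simps power2_eq_square; fail))+
  next
    case 5 show ?case by (rule DERIV_cong[OF DERIV_mult[OF dV dq] product])
  next
    case 6 show ?case by (rule nz d | (simp only: cancel mult_zero_left add_0 add_0_right times_divide_eq_left; fail)
        | (simp add: nz; fail) | (simp add: nz mult_ac; fail)
        | (simp add: nz field_simps power2_eq_square; fail))+
  qed
qed

section \<open>Riccati and linear equations with terminal values\<close>

lemma integral_from_has_real_derivative:
  fixes f :: "real \<Rightarrow> real"
  assumes "continuous_on {0..T} f" "t \<in> {0..T}"
  shows "((\<lambda>t. integral {t..T} f) has_real_derivative - f t) (at t within {0..T})"
proof -
  have "((\<lambda>t. integral {0..T} f - integral {0..t} f) has_real_derivative 0 - f t) (at t within {0..T})"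
    by (intro DERIV_diff DERIV_const integral_has_real_derivative assms)
  then have "((\<lambda>t. integral {0..T} f - integral {0..t} f) has_real_derivative - f t) (at t within {0..T})"
    by (simp only: diff_0)
  then show ?thesis
  proof (rule has_field_derivative_transform_within[OF _ zero_less_one assms(2)])
    fix t assume "t \<in> {0..T}"
    then show "integral {0..T} f - integral {0..t} f = integral {t..T} f"
      using Henstock_Kurzweil_Integration.integral_combine[of 0 t T f]
        integrable_continuous_real[OF assms(1)] by simp
  qed
qed

text \<open>
  With \<open>E t = integral {0..t} h\<close> the propagator \<open>exp (integral {t..s} h)\<close> factors as \<open>exp (- E t) * exp (E s)\<close>.
  Then \<open>t\<close> occurs only in a prefactor and in the lower limit of integration, and the product rule
  applies without differentiating under the integral.
\<close>

lemma backward_variation_of_constants: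
  fixes f h y :: "real \<Rightarrow> real"
  assumes f: "continuous_on {0..T} f" and h: "continuous_on {0..T} h" and t: "t \<in> {0..T}"
    and y: "\<And>t. t \<in> {0..T} \<Longrightarrow> y t = integral {t..T} (\<lambda>s. f s * exp (integral {t..s} h))"
  shows "(y has_real_derivative - h t * y t - f t) (at t within {0..T})"
proof -
  define E where "E t = integral {0..t} h" for t
  have dE: "(E has_real_derivative h t) (at t within {0..T})" if "t \<in> {0..T}" for t
    unfolding E_def by (rule integral_has_real_derivative[OF h that])
  then have cont: "continuous_on {0..T} (\<lambda>s. f s * exp (E s))"
    by (intro continuous_intros f DERIV_continuous_on[OF dE])
  have y': "y t = exp (- E t) * integral {t..T} (\<lambda>s. f s * exp (E s))" if t: "t \<in> {0..T}" for t
  proof -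
    have "f s * exp (integral {t..s} h) = exp (- E t) * (f s * exp (E s))" if "s \<in> {t..T}" for s
    proof -
      have "h integrable_on {0..s}"
        using that t by (intro integrable_continuous_real continuous_on_subset[OF h]) auto
      then have "integral {t..s} h = E s - E t"
        using Henstock_Kurzweil_Integration.integral_combine[of 0 t s h] that t by (simp add: E_def)
      then show ?thesis by (simp add: exp_diff exp_minus divide_inverse)
    qed
    then have "y t = integral {t..T} (\<lambda>s. exp (- E t) * (f s * exp (E s)))"
      unfolding y[OF t] by (intro Henstock_Kurzweil_Integration.integral_cong)
    then show ?thesis by simp
  qed
  have "((\<lambda>t. exp (- E t) * integral {t..T} (\<lambda>s. f s * exp (E s))) has_real_derivative
      - h t * y t - f t) (at t within {0..T})"
    by (rule derivative_eq_intros dE integral_from_has_real_derivative cont t refl)+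
       (simp add: y'[OF t] flip: exp_add)
  then show ?thesis
    by (rule has_field_derivative_transform_within[OF _ zero_less_one t]) (simp only: y')
qed

text \<open>
  Put \<open>e = exp (D (T - t))\<close> and let \<open>d\<close> be the denominator of \<open>G\<close>. Both sides of the equation are
  \<open>4 G\<^sub>3 D\<^sup>2 e / d\<^sup>2\<close>: on the right, \<open>4 G\<^sub>1 G\<^sub>3 = G\<^sub>2\<^sup>2 - D\<^sup>2\<close> turns the numerator into
  \<open>(d - G\<^sub>2 (e - 1))\<^sup>2 - D\<^sup>2 (e - 1)\<^sup>2\<close>, and \<open>d - G\<^sub>2 (e - 1) = D (e + 1)\<close>.
\<close>

lemma riccati_solution:
  fixes T G\<^sub>1 G\<^sub>2 G\<^sub>3 D t :: real
  assumes D: "D\<^sup>2 = G\<^sub>2\<^sup>2 - 4 * G\<^sub>1 * G\<^sub>3"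
    and nz: "exp (D * (T - t)) * (G\<^sub>2 + D) - G\<^sub>2 + D \<noteq> 0"
    and G: "\<And>t. G t = - 2 * G\<^sub>3 * ((exp (D * (T - t)) - 1) /
                                   (exp (D * (T - t)) * (G\<^sub>2 + D) - G\<^sub>2 + D))"
  shows "(G has_real_derivative G\<^sub>1 * (G t)\<^sup>2 + G\<^sub>2 * G t + G\<^sub>3) (at t within S)"
proof -
  define e where "e = exp (D * (T - t))"
  define d where "d = e * (G\<^sub>2 + D) - G\<^sub>2 + D"
  have "d \<noteq> 0" using nz by (simp add: d_def e_def)
  have "(G has_real_derivative 4 * G\<^sub>3 * D\<^sup>2 * e / d\<^sup>2) (at t within S)"
    unfolding G
    apply (rule derivative_eq_intros refl nz)+
    unfolding e_def[symmetric] d_def[symmetric]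
    by (simp add: field_simps \<open>d \<noteq> 0\<close>, simp add: d_def algebra_simps power2_eq_square)
  moreover have "G\<^sub>1 * (G t)\<^sup>2 + G\<^sub>2 * G t + G\<^sub>3
      = G\<^sub>3 * (4 * G\<^sub>1 * G\<^sub>3 * (e - 1)\<^sup>2 - 2 * G\<^sub>2 * (e - 1) * d + d\<^sup>2) / d\<^sup>2"
    unfolding G e_def[symmetric] d_def[symmetric]
    using \<open>d \<noteq> 0\<close> by (simp add: field_simps power2_eq_square)
  moreover have "4 * G\<^sub>1 * G\<^sub>3 * (e - 1)\<^sup>2 - 2 * G\<^sub>2 * (e - 1) * d + d\<^sup>2 = 4 * D\<^sup>2 * e"
  proof -
    have "4 * G\<^sub>1 * G\<^sub>3 = G\<^sub>2\<^sup>2 - D\<^sup>2" using D by simp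
    then show ?thesis unfolding d_def by (simp only:) (simp add: algebra_simps power2_eq_square)
  qed
  ultimately show ?thesis by (simp add: mult.assoc mult.left_commute)
qed

section \<open>Exponential-quadratic solution of the Campbell-Shiller equation\<close>

text \<open>
  The log-linear consumption ratio is affine in \<open>ln g = G m\<^sup>2 + L m + H\<close>, so after division by \<open>g\<close> the
  equation is a quadratic polynomial in \<open>m\<close>. The numbers \<open>G'\<close>, \<open>L'\<close>, \<open>H'\<close> are the values of the time
  derivatives that cancel its coefficients of \<open>m\<^sup>2\<close>, \<open>m\<close> and \<open>1\<close>.
\<close>

lemma cs_equation_exponential_quadratic:
  fixes r a \<sigma> \<alpha> \<beta> \<rho>\<^sub>1 lam \<mu>\<^sub>1 \<mu>\<^sub>2 \<theta>\<^sub>1 \<delta> \<gamma> \<phi> \<Phi> k w m :: real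
    and G\<^sub>0 G\<^sub>1 G\<^sub>2 G\<^sub>3 C G L H :: real
  assumes par: "\<sigma> > 0" "\<Phi> + \<gamma> > 0" "\<gamma> \<noteq> 1" "\<phi> \<noteq> 1" "k \<noteq> 0" "\<delta> > 0"
    and G0: "G\<^sub>0 = (1 - \<gamma> - \<Phi>)\<^sup>2 * k * \<beta>\<^sup>2 * \<rho>\<^sub>1\<^sup>2 / (2 * (\<Phi> + \<gamma>) * (1 - \<gamma>))
                 - \<Phi> * k * \<beta>\<^sup>2 / (2 * (1 - \<gamma>)) + \<beta>\<^sup>2 * (k - 1) / 2"
    and G1: "G\<^sub>1 = - 2 * (\<beta>\<^sup>2 + 2 * G\<^sub>0)"
    and G2: "G\<^sub>2 = 2 * \<alpha> + w - 2 * (1 - \<gamma> - \<Phi>) * \<beta> * \<rho>\<^sub>1 / (\<Phi> + \<gamma>)"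
    and G3: "G\<^sub>3 = - (1 - \<gamma>) / (2 * k * (\<Phi> + \<gamma>))"
    and C: "C = (1 - \<gamma>) / k * (w / (\<phi> - 1) * (1 - ln w + \<phi> * ln \<delta>) + r - \<delta> / (1 - 1 / \<phi>)
                  + (a - r)\<^sup>2 / (2 * (\<Phi> + \<gamma>) * \<sigma>\<^sup>2)
                  + lam * \<theta>\<^sub>1\<^sup>2 * \<mu>\<^sub>1\<^sup>2 / (2 * (\<Phi> + \<gamma>) * \<mu>\<^sub>2))"
  defines "G' \<equiv> G\<^sub>1 * G\<^sup>2 + G\<^sub>2 * G + G\<^sub>3"
    and "L' \<equiv> - ((1 - \<gamma> - \<Phi>) / (\<Phi> + \<gamma>) * \<beta> * \<rho>\<^sub>1 - \<alpha> - w - G\<^sub>1 * G) * L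
          - (1 - \<gamma>) * (a - r) / (k * (\<Phi> + \<gamma>) * \<sigma>)
              * (2 * ((1 - \<gamma> - \<Phi>) / (1 - \<gamma>)) * k * \<beta> * \<rho>\<^sub>1 * G + 1)"
    and "H' \<equiv> w * H - (1/2 * (\<beta>\<^sup>2 + 2 * G\<^sub>0) * L\<^sup>2
          + (1 - \<gamma> - \<Phi>) * (a - r) / ((\<Phi> + \<gamma>) * \<sigma>) * \<beta> * \<rho>\<^sub>1 * L + \<beta>\<^sup>2 * G) - C"
    and "g \<equiv> exp (G * m\<^sup>2 + L * m + H)"
  shows "g_equation r a \<sigma> \<alpha> \<beta> \<rho>\<^sub>1 lam \<mu>\<^sub>1 \<mu>\<^sub>2 \<theta>\<^sub>1 \<delta> \<gamma> \<phi> \<Phi> k m (cs_ratio \<delta> \<gamma> \<phi> k w g) g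
           (g * (G' * m\<^sup>2 + L' * m + H')) (g * (2 * G * m + L)) (g * (2 * G + (2 * G * m + L)\<^sup>2)) = 0"
proof -
  have g: "g > 0" "ln g = G * m\<^sup>2 + L * m + H" by (simp_all add: g_def)
  \<comment> \<open>Names for the composite coefficients; with them the cancellation is a
      polynomial identity.\<close>
  define Q where "Q = G * m\<^sup>2 + L * m + H"
  define f where "f = (1 - \<gamma> - \<Phi>) / (\<Phi> + \<gamma>) * \<beta> * \<rho>\<^sub>1"
  define j where "j = (1 - \<gamma> - \<Phi>) * (a - r) / ((\<Phi> + \<gamma>) * \<sigma>) * \<beta> * \<rho>\<^sub>1"
  define n where "n = (1 - \<gamma>) * (a - r) / (k * (\<Phi> + \<gamma>) * \<sigma>)"
  define N where "N = lam * \<theta>\<^sub>1\<^sup>2 * \<mu>\<^sub>1\<^sup>2 / (2 * (\<Phi> + \<gamma>) * \<mu>\<^sub>2)"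
  define Y where "Y = \<delta> / (1 - 1 / \<phi>)"
  have nz: "\<sigma> \<noteq> 0" "\<Phi> + \<gamma> \<noteq> 0" "1 - \<gamma> \<noteq> 0" "\<phi> - 1 \<noteq> 0" "k \<noteq> 0" using par by simp_all
  have ratio: "(1 - \<gamma>) / (k * (\<phi> - 1)) * cs_ratio \<delta> \<gamma> \<phi> k w g
      = (1 - \<gamma>) / k * (w / (\<phi> - 1) * (1 - ln w + \<phi> * ln \<delta>)) - w * Q"
  proof -
    have cancel: "(1 - \<gamma>) / (k * (\<phi> - 1)) * (w * (S + k * ((1 - \<phi>) / (1 - \<gamma>)) * Q))
        = (1 - \<gamma>) / k * (w / (\<phi> - 1) * S) - w * Q" for S
      using nz by (simp add: divide_simps) algebra
    show ?thesis
      unfolding cs_ratio_def g(2) Q_def[symmetric] cancel using \<open>\<delta> > 0\<close> by (simp only: ln_powr)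
  qed
  have "q / k * ((\<sigma> * m + a - r)\<^sup>2 / (2 * P * \<sigma>\<^sup>2))
      = - (- q / (2 * k * P)) * m\<^sup>2 + q * (a - r) / (k * P * \<sigma>) * m + q / k * ((a - r)\<^sup>2 / (2 * P * \<sigma>\<^sup>2))"
    if "P \<noteq> 0" for P q
    using that nz(1,5) by (simp add: field_simps power2_eq_square)
  from this[OF nz(2)]
  have square: "(1 - \<gamma>) / k * ((\<sigma> * m + a - r)\<^sup>2 / (2 * (\<Phi> + \<gamma>) * \<sigma>\<^sup>2))
      = - G\<^sub>3 * m\<^sup>2 + n * m + (1 - \<gamma>) / k * ((a - r)\<^sup>2 / (2 * (\<Phi> + \<gamma>) * \<sigma>\<^sup>2))"
    unfolding G3 n_def .
  have "c / (P * \<sigma>) * (\<sigma> * m + a - r) * \<beta> * \<rho>\<^sub>1 = c / P * \<beta> * \<rho>\<^sub>1 * m + c * (a - r) / (P * \<sigma>) * \<beta> * \<rho>\<^sub>1"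
    if "P \<noteq> 0" for c P
    using that nz(1) by (simp add: field_simps)
  from this[OF nz(2)]
  have drift: "(1 - \<gamma> - \<Phi>) / ((\<Phi> + \<gamma>) * \<sigma>) * (\<sigma> * m + a - r) * \<beta> * \<rho>\<^sub>1 = f * m + j"
    unfolding f_def j_def .
  have "q * (a - r) / (k * P * \<sigma>) * (2 * (c / q) * k * \<beta> * \<rho>\<^sub>1 * G + 1)
      = 2 * (c * (a - r) / (P * \<sigma>) * \<beta> * \<rho>\<^sub>1) * G + q * (a - r) / (k * P * \<sigma>)"
    if "P \<noteq> 0" "q \<noteq> 0" for c P q
    using that nz(1,5) by (simp add: field_simps)
  from this[OF nz(2,3)]
  have "n * (2 * ((1 - \<gamma> - \<Phi>) / (1 - \<gamma>)) * k * \<beta> * \<rho>\<^sub>1 * G + 1) = 2 * j * G + n"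
    unfolding n_def j_def .
  then have L': "L' = - (f - \<alpha> - w - G\<^sub>1 * G) * L - (2 * j * G + n)"
    unfolding L'_def f_def[symmetric] n_def[symmetric] by (simp only:)
  have H': "H' = w * H - (1/2 * (\<beta>\<^sup>2 + 2 * G\<^sub>0) * L\<^sup>2 + j * L + \<beta>\<^sup>2 * G) - C"
    unfolding H'_def j_def ..
  have G2': "G\<^sub>2 = 2 * \<alpha> + w - 2 * f" unfolding G2 f_def by simp
  have G0': "G\<^sub>0 = (1 - \<gamma> - \<Phi>)\<^sup>2 / (2 * (\<Phi> + \<gamma>) * (1 - \<gamma>)) * k * \<beta>\<^sup>2 * \<rho>\<^sub>1\<^sup>2
      - \<Phi> * k * \<beta>\<^sup>2 / (2 * (1 - \<gamma>)) + \<beta>\<^sup>2 * (k - 1) / 2"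
    unfolding G0 by simp
  have "u * (W + r - Y + S + N) = u * W + u * (N + r - Y) + u * S" for u W S
    by (simp add: algebra_simps)
  note C' = C[folded N_def Y_def, unfolded this]
  have gm2: "(g * (2 * G * m + L))\<^sup>2 / g = g * (2 * G * m + L)\<^sup>2"
    using g(1) by (simp add: power2_eq_square)
  have "g_equation r a \<sigma> \<alpha> \<beta> \<rho>\<^sub>1 lam \<mu>\<^sub>1 \<mu>\<^sub>2 \<theta>\<^sub>1 \<delta> \<gamma> \<phi> \<Phi> k m (cs_ratio \<delta> \<gamma> \<phi> k w g) g
           (g * (G' * m\<^sup>2 + L' * m + H')) (g * (2 * G * m + L)) (g * (2 * G + (2 * G * m + L)\<^sup>2))
     = g * (G' * m\<^sup>2 + L' * m + H' + (1 - \<gamma>) / (k * (\<phi> - 1)) * cs_ratio \<delta> \<gamma> \<phi> k w g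
        + (1 - \<gamma>) / k * ((\<sigma> * m + a - r)\<^sup>2 / (2 * (\<Phi> + \<gamma>) * \<sigma>\<^sup>2)) + (1 - \<gamma>) / k * (N + r - Y)
        + 1/2 * \<beta>\<^sup>2 * (2 * G + (2 * G * m + L)\<^sup>2) + (f * m + j - \<alpha> * m) * (2 * G * m + L)
        + G\<^sub>0 * (2 * G * m + L)\<^sup>2)"
    unfolding g_equation_def gm2 G0'[symmetric] drift N_def[symmetric] Y_def[symmetric]
    by (simp only: distrib_left distrib_right left_diff_distrib right_diff_distrib mult_ac)
  also have "G' * m\<^sup>2 + L' * m + H' + (1 - \<gamma>) / (k * (\<phi> - 1)) * cs_ratio \<delta> \<gamma> \<phi> k w g
        + (1 - \<gamma>) / k * ((\<sigma> * m + a - r)\<^sup>2 / (2 * (\<Phi> + \<gamma>) * \<sigma>\<^sup>2)) + (1 - \<gamma>) / k * (N + r - Y)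
        + 1/2 * \<beta>\<^sup>2 * (2 * G + (2 * G * m + L)\<^sup>2) + (f * m + j - \<alpha> * m) * (2 * G * m + L)
        + G\<^sub>0 * (2 * G * m + L)\<^sup>2
      = G' * m\<^sup>2 + L' * m + (H' + C) - w * Q - G\<^sub>3 * m\<^sup>2 + n * m
        + 1/2 * \<beta>\<^sup>2 * (2 * G + (2 * G * m + L)\<^sup>2) + (f * m + j - \<alpha> * m) * (2 * G * m + L)
        + G\<^sub>0 * (2 * G * m + L)\<^sup>2"
    unfolding ratio square C'
    by (simp only: mult_minus_left diff_conv_add_uminus add_ac)
  also have "\<dots> = 0"
    unfolding L' H' G'_def G2' G1 Q_def by (simp add: algebra_simps power2_eq_square)
  finally show ?thesis by simp
qed

section \<open>The Campbell-Shiller candidate\<close>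

text \<open>
  A vanishing second moment would make the claims zero almost surely. Positivity is needed to divide
  by \<open>\<mu>\<^sub>2\<close> in the retention \<open>q\<close>.
\<close>

lemma claim_law_second_moment_pos:
  assumes "is_claim_law N \<mu>\<^sub>1 \<mu>\<^sub>2"
  shows "0 < \<mu>\<^sub>2"
proof -
  interpret prob_space N using assms by (simp add: is_claim_law_def)
  have N: "AE z in N. 0 < z" "integrable N (\<lambda>z. z\<^sup>2)" "\<mu>\<^sub>2 = (\<integral>z. z\<^sup>2 \<partial>N)"
    using assms by (auto simp: is_claim_law_def)
  have "\<mu>\<^sub>2 \<noteq> 0"
  proof
    assume "\<mu>\<^sub>2 = 0"
    then have "AE z in N. z\<^sup>2 = 0"
      using integral_nonneg_eq_0_iff_AE[OF N(2)] N(3) by simp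
    with N(1) have "AE z in N. False" by eventually_elim simp
    then show False by simp
  qed
  moreover have "0 \<le> \<mu>\<^sub>2" unfolding N(3) by (rule integral_nonneg_AE) simp
  ultimately show ?thesis by simp
qed


theorem theorem5p1:
  fixes T r a \<sigma> \<alpha> \<beta> \<rho>\<^sub>1 lam \<mu>\<^sub>1 \<mu>\<^sub>2 \<theta>\<^sub>1 \<delta> \<gamma> \<phi> \<Phi> k w :: real
    and claim_law :: "real measure"
    and G\<^sub>0 G\<^sub>1 G\<^sub>2 G\<^sub>3 D :: real
    and G L H :: "real \<Rightarrow> real"
    and g :: "real \<Rightarrow> real \<Rightarrow> real"
    and v :: "real \<Rightarrow> real \<Rightarrow> real \<Rightarrow> real"
    and \<pi>CS qCS cCS :: "real \<Rightarrow> real \<Rightarrow> real \<Rightarrow> real"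
    and \<xi>\<^sub>1CS \<xi>\<^sub>2CS \<xi>\<^sub>3CS :: "real \<Rightarrow> real \<Rightarrow> real"
  assumes "T > 0" "r > 0" "a > r" "\<sigma> > 0" "\<alpha> > 0" "\<beta> > 0" "\<bar>\<rho>\<^sub>1\<bar> \<le> 1"
    and "lam > 0" "is_claim_law claim_law \<mu>\<^sub>1 \<mu>\<^sub>2"
    and "\<delta> > 0" "\<gamma> > 0" "\<gamma> \<noteq> 1" "\<phi> > 0" "\<phi> \<noteq> 1" "\<Phi> \<ge> 0" "k \<noteq> 0" "w > 0"
    and G0: "G\<^sub>0 = (1 - \<gamma> - \<Phi>)\<^sup>2 * k * \<beta>\<^sup>2 * \<rho>\<^sub>1\<^sup>2 / (2 * (\<Phi> + \<gamma>) * (1 - \<gamma>))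
                 - \<Phi> * k * \<beta>\<^sup>2 / (2 * (1 - \<gamma>)) + \<beta>\<^sup>2 * (k - 1) / 2"
    and G1: "G\<^sub>1 = - 2 * (\<beta>\<^sup>2 + 2 * G\<^sub>0)"
    and G2: "G\<^sub>2 = 2 * \<alpha> + w - 2 * (1 - \<gamma> - \<Phi>) * \<beta> * \<rho>\<^sub>1 / (\<Phi> + \<gamma>)"
    and G3: "G\<^sub>3 = - (1 - \<gamma>) / (2 * k * (\<Phi> + \<gamma>))"
    and D: "D = sqrt (G\<^sub>2\<^sup>2 - 4 * G\<^sub>1 * G\<^sub>3)"
    and discriminant: "G\<^sub>2\<^sup>2 - 4 * G\<^sub>1 * G\<^sub>3 \<ge> 0"
    and no_explosion: "\<And>t. t \<in> {0..T} \<Longrightarrow> exp (D * (T - t)) * (G\<^sub>2 + D) - G\<^sub>2 + D \<noteq> 0"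
    and G: "\<And>t. G t = - 2 * G\<^sub>3 * ((exp (D * (T - t)) - 1) /
                                   (exp (D * (T - t)) * (G\<^sub>2 + D) - G\<^sub>2 + D))"
    and L: "\<And>t. L t = (1 - \<gamma>) * (a - r) / (k * (\<Phi> + \<gamma>) * \<sigma>) *
              integral {t..T} (\<lambda>s. (2 * ((1 - \<gamma> - \<Phi>) / (1 - \<gamma>)) * k * \<beta> * \<rho>\<^sub>1 * G s + 1) *
                exp (integral {t..s}
                  (\<lambda>u. (1 - \<gamma> - \<Phi>) / (\<Phi> + \<gamma>) * \<beta> * \<rho>\<^sub>1 - \<alpha> - w - G\<^sub>1 * G u)))"
    and H: "\<And>t. H t =
              integral {t..T} (\<lambda>s. (1/2 * (\<beta>\<^sup>2 + 2 * G\<^sub>0) * (L s)\<^sup>2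
                  + (1 - \<gamma> - \<Phi>) * (a - r) / ((\<Phi> + \<gamma>) * \<sigma>) * \<beta> * \<rho>\<^sub>1 * L s + \<beta>\<^sup>2 * G s) *
                exp (- w * (s - t)))
              + (1 - \<gamma>) / k * (w / (\<phi> - 1) * (1 - ln w + \<phi> * ln \<delta>) + r - \<delta> / (1 - 1 / \<phi>)
                  + (a - r)\<^sup>2 / (2 * (\<Phi> + \<gamma>) * \<sigma>\<^sup>2)
                  + lam * \<theta>\<^sub>1\<^sup>2 * \<mu>\<^sub>1\<^sup>2 / (2 * (\<Phi> + \<gamma>) * \<mu>\<^sub>2)) *
                ((1 - exp (- w * (T - t))) / w)"
    and g: "\<And>t m. g t m = exp (G t * m\<^sup>2 + L t * m + H t)"
    and v: "\<And>t x m. v t x m = 1 / (1 - \<gamma>) * x powr (1 - \<gamma>) * g t m powr k"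
    and \<pi>CS: "\<And>t x m. \<pi>CS t x m = x / ((\<Phi> + \<gamma>) * \<sigma>\<^sup>2) *
              ((\<sigma> * m + a - r)
                + (1 - \<gamma> - \<Phi>) / (1 - \<gamma>) * k * \<beta> * \<rho>\<^sub>1 * \<sigma> * (deriv (g t) m / g t m))"
    and qCS: "\<And>t x m. qCS t x m = \<theta>\<^sub>1 * \<mu>\<^sub>1 / ((\<Phi> + \<gamma>) * \<mu>\<^sub>2) * x"
    and cCS: "\<And>t x m. cCS t x m = x * \<delta> powr \<phi> * g t m powr (k * ((1 - \<phi>) / (1 - \<gamma>)))"
    and \<xi>1: "\<And>t m. \<xi>\<^sub>1CS t m = \<Phi> / ((\<Phi> + \<gamma>) * \<sigma>) * (\<sigma> * m + a - r)
              + \<Phi> * k * \<beta> * \<rho>\<^sub>1 / ((\<Phi> + \<gamma>) * (1 - \<gamma>)) * (2 * G t * m + L t)"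
    and \<xi>2: "\<And>t m. \<xi>\<^sub>2CS t m =
              \<Phi> / (1 - \<gamma>) * k * \<beta> * sqrt (1 - \<rho>\<^sub>1\<^sup>2) * (2 * G t * m + L t)"
    and \<xi>3: "\<And>t m. \<xi>\<^sub>3CS t m = \<Phi> * \<theta>\<^sub>1 * \<mu>\<^sub>1 * sqrt lam / ((\<Phi> + \<gamma>) * sqrt \<mu>\<^sub>2)"
  shows
    "(\<exists>gt gm gmm. factor_partials T g gt gm gmm \<and>
        (\<forall>t\<in>{0..T}. \<forall>m.
           g_equation r a \<sigma> \<alpha> \<beta> \<rho>\<^sub>1 lam \<mu>\<^sub>1 \<mu>\<^sub>2 \<theta>\<^sub>1 \<delta> \<gamma> \<phi> \<Phi> k m
             (cs_ratio \<delta> \<gamma> \<phi> k w (g t m)) (g t m) (gt t m) (gm t m) (gmm t m) = 0))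
     \<and> (\<forall>x>0. \<forall>m. v T x m = 1 / (1 - \<gamma>) * x powr (1 - \<gamma>))
     \<and> (\<exists>vt vx vm vxx vmm vxm. value_partials T v vt vx vm vxx vmm vxm \<and>
        (\<forall>t\<in>{0..T}. \<forall>x>0. \<forall>m.
           let B = hjbi_bracket r a \<sigma> \<alpha> \<beta> \<rho>\<^sub>1 lam \<mu>\<^sub>1 \<mu>\<^sub>2 \<theta>\<^sub>1 \<delta> \<gamma> \<phi> \<Phi> x m (v t x m) (vt t x m)
                     (vx t x m) (vm t x m) (vxx t x m) (vmm t x m) (vxm t x m)
           in attains_max_min controls B
                (\<pi>CS t x m, qCS t x m, cCS t x m) (\<xi>\<^sub>1CS t m, \<xi>\<^sub>2CS t m, \<xi>\<^sub>3CS t m)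
              \<and> (SUP u\<in>controls. INF \<xi>. B u \<xi>)
                  + ereal ((1 - \<gamma>) * v t x m / (\<phi> - 1) *
                      (cs_ratio \<delta> \<gamma> \<phi> k w (g t m) - cCS t x m / x)) = 0))"
proof -
  have P: "\<Phi> + \<gamma> > 0" using \<open>\<gamma> > 0\<close> \<open>\<Phi> \<ge> 0\<close> by simp
  have mu2: "\<mu>\<^sub>2 > 0" by (rule claim_law_second_moment_pos) fact
  define K where "K = (1 - \<gamma>) * (a - r) / (k * (\<Phi> + \<gamma>) * \<sigma>)"
  define C where "C = (1 - \<gamma>) / k * (w / (\<phi> - 1) * (1 - ln w + \<phi> * ln \<delta>) + r - \<delta> / (1 - 1 / \<phi>)
                  + (a - r)\<^sup>2 / (2 * (\<Phi> + \<gamma>) * \<sigma>\<^sup>2)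
                  + lam * \<theta>\<^sub>1\<^sup>2 * \<mu>\<^sub>1\<^sup>2 / (2 * (\<Phi> + \<gamma>) * \<mu>\<^sub>2))"
  define h where "h u = (1 - \<gamma> - \<Phi>) / (\<Phi> + \<gamma>) * \<beta> * \<rho>\<^sub>1 - \<alpha> - w - G\<^sub>1 * G u" for u
  define fL where "fL s = 2 * ((1 - \<gamma> - \<Phi>) / (1 - \<gamma>)) * k * \<beta> * \<rho>\<^sub>1 * G s + 1" for s
  define fH where "fH s = 1/2 * (\<beta>\<^sup>2 + 2 * G\<^sub>0) * (L s)\<^sup>2
                  + (1 - \<gamma> - \<Phi>) * (a - r) / ((\<Phi> + \<gamma>) * \<sigma>) * \<beta> * \<rho>\<^sub>1 * L s + \<beta>\<^sup>2 * G s" for s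
  define dG where "dG t = G\<^sub>1 * (G t)\<^sup>2 + G\<^sub>2 * G t + G\<^sub>3" for t
  define dL where "dL t = - h t * L t - K * fL t" for t
  define dH where "dH t = w * H t - fH t - C" for t
  have D2: "D\<^sup>2 = G\<^sub>2\<^sup>2 - 4 * G\<^sub>1 * G\<^sub>3" using D discriminant by simp
  have G': "(G has_real_derivative dG t) (at t within {0..T})" if "t \<in> {0..T}" for t
    unfolding dG_def by (rule riccati_solution[OF D2 no_explosion[OF that] G])
  have contG: "continuous_on {0..T} G" by (rule DERIV_continuous_on[OF G'])
  have L_eq: "L = (\<lambda>t. K * integral {t..T} (\<lambda>s. fL s * exp (integral {t..s} h)))"
    unfolding K_def fL_def[abs_def] h_def[abs_def] by (rule ext, rule L)
  have cont_h: "continuous_on {0..T} h" and cont_fL: "continuous_on {0..T} fL"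
    unfolding h_def[abs_def] fL_def[abs_def] by (intro continuous_intros contG)+
  have L': "(L has_real_derivative dL t) (at t within {0..T})" if "t \<in> {0..T}" for t
    using DERIV_cmult[OF backward_variation_of_constants[OF cont_fL cont_h that refl], of K]
    unfolding L_eq dL_def by (rule DERIV_cong) (simp add: algebra_simps)
  have contL: "continuous_on {0..T} L" by (rule DERIV_continuous_on[OF L'])
  have cont_fH: "continuous_on {0..T} fH"
    unfolding fH_def[abs_def] by (intro continuous_intros contG contL)
  \<comment> \<open>The integral in \<open>H\<close> is again of variation-of-constants form, with the constant rate \<open>- w\<close>.\<close>
  define yH where "yH t = integral {t..T} (\<lambda>s. fH s * exp (- w * (s - t)))" for t
  have H_eq: "H = (\<lambda>t. yH t + C * ((1 - exp (- w * (T - t))) / w))"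
    unfolding yH_def C_def fH_def by (rule ext, rule H)
  have yH: "(yH has_real_derivative - (- w) * yH t - fH t) (at t within {0..T})" if "t \<in> {0..T}" for t
  proof (rule backward_variation_of_constants[OF cont_fH continuous_on_const that])
    fix t assume "t \<in> {0..T}"
    show "yH t = integral {t..T} (\<lambda>s. fH s * exp (integral {t..s} (\<lambda>_. - w)))"
      unfolding yH_def by (rule Henstock_Kurzweil_Integration.integral_cong) (simp add: mult.commute)
  qed
  have H': "(H has_real_derivative dH t) (at t within {0..T})" if "t \<in> {0..T}" for t
  proof -
    have "((\<lambda>t. C * ((1 - exp (- w * (T - t))) / w)) has_real_derivative - C * exp (- w * (T - t)))
        (at t within {0..T})"
      using \<open>w > 0\<close> by (auto intro!: derivative_eq_intros)
    from DERIV_add[OF yH[OF that] this] show ?thesis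
      unfolding H_eq dH_def by (rule DERIV_cong) (use \<open>w > 0\<close> in \<open>simp add: field_simps\<close>)
  qed

  define gt where "gt t m = g t m * (dG t * m\<^sup>2 + dL t * m + dH t)" for t m
  define gm where "gm t m = g t m * (2 * G t * m + L t)" for t m
  define gmm where "gmm t m = g t m * (2 * G t + (2 * G t * m + L t)\<^sup>2)" for t m
  have g_pos: "0 < g t m" for t m by (simp add: g)
  have dm: "((\<lambda>n. g t n) has_real_derivative gm t m) (at m)" for t m
    unfolding gm_def g by (auto intro!: derivative_eq_intros)
  have partials: "factor_partials T g gt gm gmm"
    unfolding factor_partials_def
  proof (intro ballI allI conjI)
    fix t m assume t: "t \<in> {0..T}"
    show "((\<lambda>s. g s m) has_real_derivative gt t m) (at t within {0..T})"
      unfolding gt_def g by (rule derivative_eq_intros refl G' L' H' t)+ simp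
    show "((\<lambda>n. g t n) has_real_derivative gm t m) (at m)" by (rule dm)
    show "((\<lambda>n. gm t n) has_real_derivative gmm t m) (at m)"
      unfolding gm_def
      by (rule derivative_eq_intros refl dm)+ (simp add: gmm_def gm_def algebra_simps power2_eq_square)
  qed
  have cs: "g_equation r a \<sigma> \<alpha> \<beta> \<rho>\<^sub>1 lam \<mu>\<^sub>1 \<mu>\<^sub>2 \<theta>\<^sub>1 \<delta> \<gamma> \<phi> \<Phi> k m
      (cs_ratio \<delta> \<gamma> \<phi> k w (g t m)) (g t m) (gt t m) (gm t m) (gmm t m) = 0" for t m
    unfolding gt_def gm_def gmm_def dG_def dL_def dH_def h_def fL_def fH_def K_def unfolding g
    by (rule cs_equation_exponential_quadratic[OF \<open>\<sigma> > 0\<close> P \<open>\<gamma> \<noteq> 1\<close> \<open>\<phi> \<noteq> 1\<close> \<open>k \<noteq> 0\<close> \<open>\<delta> > 0\<close>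
          G0 G1 G2 G3 C_def])

  define V where "V t x m = x powr (1 - \<gamma>) * g t m powr k" for t x m
  define R where "R t m = \<delta> powr \<phi> * g t m powr (k * ((1 - \<phi>) / (1 - \<gamma>)))" for t m
  have vV: "v t x m = V t x m / (1 - \<gamma>)" for t x m by (simp add: v V_def)
  have cR: "cCS t x m = x * R t m" for t x m by (simp add: cCS R_def mult.assoc)
  have deriv_g: "deriv (g t) m = gm t m" for t m by (rule DERIV_imp_deriv[OF dm])
  have gm_g: "gm t m / g t m = 2 * G t * m + L t" for t m
    using g_pos[of t m] by (simp add: gm_def)
  have vT: "v T x m = 1 / (1 - \<gamma>) * x powr (1 - \<gamma>)" for x m
    by (simp add: v g G L H)
  have hjbi: "attains_max_min controls B (\<pi>CS t x m, qCS t x m, cCS t x m)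
        (\<xi>\<^sub>1CS t m, \<xi>\<^sub>2CS t m, \<xi>\<^sub>3CS t m)" (is ?saddle)
      "(SUP u\<in>controls. INF \<xi>. B u \<xi>) + ereal ((1 - \<gamma>) * v t x m / (\<phi> - 1) *
          (cs_ratio \<delta> \<gamma> \<phi> k w (g t m) - cCS t x m / x)) = 0" (is ?value)
    if x: "x > 0" and
      B: "B = hjbi_bracket r a \<sigma> \<alpha> \<beta> \<rho>\<^sub>1 lam \<mu>\<^sub>1 \<mu>\<^sub>2 \<theta>\<^sub>1 \<delta> \<gamma> \<phi> \<Phi> x m (v t x m)
          (V t x m * k / (1 - \<gamma>) * (gt t m / g t m)) (V t x m / x)
          (V t x m * k / (1 - \<gamma>) * (gm t m / g t m)) (- \<gamma> * V t x m / x\<^sup>2)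
          (V t x m * k / (1 - \<gamma>) * (gmm t m / g t m + (k - 1) * (gm t m / g t m)\<^sup>2))
          (V t x m / x * k * (gm t m / g t m))" for t x m B
  proof -
    note crra = hjbi_power_utility[OF \<open>\<sigma> > 0\<close> \<open>\<bar>\<rho>\<^sub>1\<bar> \<le> 1\<close> \<open>lam > 0\<close> mu2 \<open>\<delta> > 0\<close> \<open>\<gamma> > 0\<close>
        \<open>\<gamma> \<noteq> 1\<close> \<open>\<phi> > 0\<close> \<open>\<phi> \<noteq> 1\<close> \<open>\<Phi> \<ge> 0\<close> \<open>k \<noteq> 0\<close> x g_pos[of t m],
        folded V_def R_def]
    show ?saddle
      unfolding B vV \<pi>CS qCS cR \<xi>1 \<xi>2 \<xi>3 deriv_g gm_g[symmetric] by (rule crra(1))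
    \<comment> \<open>The equation is affine in the consumption ratio, so replacing the log-linear ratio by the
        actual one leaves only their difference.\<close>
    have "g_equation r a \<sigma> \<alpha> \<beta> \<rho>\<^sub>1 lam \<mu>\<^sub>1 \<mu>\<^sub>2 \<theta>\<^sub>1 \<delta> \<gamma> \<phi> \<Phi> k m (R t m) (g t m) (gt t m) (gm t m) (gmm t m)
        = (1 - \<gamma>) / (k * (\<phi> - 1)) * (R t m - cs_ratio \<delta> \<gamma> \<phi> k w (g t m)) * g t m"
      using cs[of m t] unfolding g_equation_def by (simp add: right_diff_distrib left_diff_distrib)
    then have "(SUP u\<in>controls. INF \<xi>. B u \<xi>) = ereal (V t x m * k / (1 - \<gamma>) / g t m *
        ((1 - \<gamma>) / (k * (\<phi> - 1)) * (R t m - cs_ratio \<delta> \<gamma> \<phi> k w (g t m)) * g t m))"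
      unfolding B vV by (simp only: crra(2))
    moreover have "V t x m * k / (1 - \<gamma>) / g t m *
        ((1 - \<gamma>) / (k * (\<phi> - 1)) * (R t m - cs_ratio \<delta> \<gamma> \<phi> k w (g t m)) * g t m)
        + (1 - \<gamma>) * v t x m / (\<phi> - 1) * (cs_ratio \<delta> \<gamma> \<phi> k w (g t m) - cCS t x m / x) = 0"
    proof -
      have "g t m \<noteq> 0" "1 - \<gamma> \<noteq> 0" "k \<noteq> 0" "\<phi> - 1 \<noteq> 0" "x \<noteq> 0"
        using g_pos[of t m] \<open>\<gamma> \<noteq> 1\<close> \<open>\<phi> \<noteq> 1\<close> \<open>k \<noteq> 0\<close> x by auto
      then show ?thesis unfolding vV cR by (simp add: divide_simps) algebra
    qed
    ultimately show ?value by simp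
  qed
  note vp = value_partials_power_utility[OF partials g_pos \<open>\<gamma> \<noteq> 1\<close> v, folded V_def]
  show ?thesis
  proof (intro conjI, goal_cases)
    case 1
    show ?case using partials cs by blast
  next
    case 2
    show ?case using vT by blast
  next
    case 3
    show ?case
      by (intro exI conjI, rule vp)
         (unfold Let_def, intro ballI allI impI conjI; rule hjbi[OF _ refl], assumption)
  qed
qed

end
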